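(* Let $\mathcal{H}$ be a separable Hilbert space, let $\Psi=\{\psi_i\}_{i\in I}$ and $\Phi=\{\phi_i\}_{i\in I}$ be frames for $\mathcal{H}$, let $U\in\mathcal{B}(\mathcal{H})$ have closed range, and suppose that the operator $\mathbf{G}_{U,\Phi,\Psi}$ on $\ell^2(I)$ has closed range. (1) The following assertions are equivalent: (1a) There exists a dual $\Phi^{(U,\Psi)}$ of $\Phi$ on $\mathsf{R}(U)$ such that $\left(\mathbf{G}_{U,\Phi,\Psi}\right)^{\dagger}=\mathbf{G}_{U^{\dagger},\widetilde{\Psi},\Phi^{(U,\Psi)}}$. (1b) $\left(\mathbf{G}_{U,\Phi,\Psi}\right)^{\dagger}=\mathbf{G}_{U^{\dagger},\widetilde{\Psi},\widetilde{UU^{\dagger}\Phi}}$. (1c) $\mathsf{R}(U^* )=S_{\Psi}\mathsf{R}(U^* )$. (2) The following assertions are equivalent: (2a) There exists a dual $\Psi^{\overline{(U,\Phi)}}$ of $\Psi$ on $\mathsf{R}(U^* )$ such that $\left(\mathbf{G}_{U,\Phi,\Psi}\right)^{\dagger}=\mathbf{G}_{U^{\dagger},\Psi^{\overline{(U,\Phi)}},\widetilde{\Phi}}$. (2b) $\left(\mathbf{G}_{U,\Phi,\Psi}\right)^{\dagger}=\mathbf{G}_{U^{\dagger},\widetilde{U^{\dagger}U\Psi},\widetilde{\Phi}}$. (2c) $\mathsf{R}(U)=S_{\Phi}\mathsf{R}(U)$.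
   Context: All Hilbert spaces are separable, $I$ is a countable index set, $\ell^2=\ell^2(I)$, $\mathcal{B}(\mathcal{H})$ is the set of bounded linear operators on $\mathcal{H}$, and $\mathsf{R}(O)$ is the range of an operator $O$. A sequence $\Phi=\{\phi_i\}_{i\in I}$ is a Bessel sequence with Bessel bound $B_\Phi>0$ in a Hilbert space $\mathcal{K}$ if $\sum_{i}|\langle f,\phi_i\rangle|^2\le B_\Phi\|f\|^2$ for all $f\in\mathcal{K}$, and a frame for $\mathcal{K}$ if moreover $A_\Phi\|f\|^2\le\sum_i|\langle f,\phi_i\rangle|^2$ for some $A_\Phi>0$ and all $f\in\mathcal{K}$. For a Bessel sequence, $T_\Phi\{c_i\}=\sum_i c_i\phi_i$ ($T_\Phi$ defined on $\ell^2$) is the synthesis operator, $T_\Phi^*f=\{\langle f,\phi_i\rangle\}_i$ its adjoint, $S_\Phi=T_\Phi T_\Phi^*$ the frame operator. The canonical dual of a frame $\Phi$ for $\mathcal{K}$ is $\widetilde\Phi=\{S_\Phi^{-1}\phi_i\}_i$, with $S_\Phi$ inverted on $\mathcal{K}$. For a bounded operator $O$ write $O\Phi=\{O\phi_i\}_i$. The sequences $UU^\dagger\Phi$ and $U^\dagger U\Psi$ are frames for the closed subspaces $\mathsf{R}(U)$ and $\mathsf{R}(U^* )$ respectively, and $\widetilde{UU^\dagger\Phi}$, $\widetilde{U^\dagger U\Psi}$ denote their canonical duals in these subspaces. A dual of $\Phi$ on a closed subspace $\mathcal{V}\subseteq\mathcal{H}$ is a Bessel sequence $\Phi'=\{\phi'_i\}_{i}$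 of elements of $\mathcal{V}$ with $f=\sum_i\langle f,\phi_i\rangle\phi'_i$ for all $f\in\mathcal{V}$. For Bessel sequences $\Phi,\Psi$ in $\mathcal{H}$ and $U\in\mathcal{B}(\mathcal{H})$, the $U$-cross Gram matrix is $(\mathbf{G}_{U,\Phi,\Psi})_{i,j}=\langle U\psi_j,\phi_i\rangle$, equivalently the bounded operator $T_\Phi^*UT_\Psi$ on $\ell^2$. For a bounded operator $O$ with closed range, $O^\dagger$ is its Moore–Penrose pseudo-inverse: the unique bounded operator with $\ker O^\dagger=\mathsf{R}(O)^\perp$, $\mathsf{R}(O^\dagger)=(\ker O)^\perp$, $OO^\dagger O=O$. *)

theory Defs
  imports "HOL-Analysis.Analysis"
begin

section \<open>Complex Hilbert spaces\<close>

text \<open>The complex inner product is linear in its first and conjugate-linear in its second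
  argument. The real inner product and the norm are those induced by the complex one.\<close>

class complex_hilbert_space = real_inner + complete_space +
  fixes scaleC :: "complex \<Rightarrow> 'a \<Rightarrow> 'a" (infixr "*\<^sub>C" 75)
    and cinner :: "'a \<Rightarrow> 'a \<Rightarrow> complex"
  assumes scaleC_add_right: "a *\<^sub>C (x + y) = a *\<^sub>C x + a *\<^sub>C y"
    and scaleC_add_left: "(a + b) *\<^sub>C x = a *\<^sub>C x + b *\<^sub>C x"
    and scaleC_scaleC: "a *\<^sub>C b *\<^sub>C x = (a * b) *\<^sub>C x"
    and scaleR_scaleC: "r *\<^sub>R x = complex_of_real r *\<^sub>C x"
    and cinner_add_left: "cinner (x + y) z = cinner x z + cinner y z"
    and cinner_scaleC_left: "cinner (a *\<^sub>C x) y = a * cinner x y"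
    and cinner_commute: "cinner x y = cnj (cinner y x)"
    and inner_eq_Re_cinner: "inner x y = Re (cinner x y)"


section \<open>The space of square-summable families\<close>

typedef 'i ell2 = "{c :: 'i \<Rightarrow> complex. (\<lambda>i. (cmod (c i))\<^sup>2) summable_on UNIV}"
  morphisms coord Abs_ell2
  by (rule exI[of _ "\<lambda>_. 0"]) simp

lemma coord_summable: "(\<lambda>i. (cmod (coord c i))\<^sup>2) summable_on UNIV"
  using coord[of c] by simp

lemma coord_Abs: "(\<lambda>i. (cmod (c i))\<^sup>2) summable_on UNIV \<Longrightarrow> coord (Abs_ell2 c) = c"
  by (simp add: Abs_ell2_inverse)

lemma ell2_eqI: "(\<And>i. coord c i = coord d i) \<Longrightarrow> c = d"
  using coord_inject by blast

lemma sq_summable_mult: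
  assumes "(\<lambda>i. (cmod (c i))\<^sup>2) summable_on UNIV"
  shows "(\<lambda>i. (cmod (a * c i))\<^sup>2) summable_on UNIV"
  using summable_on_cmult_right[OF assms, of "(cmod a)\<^sup>2"]
  by (simp add: norm_mult power_mult_distrib)

lemma sq_summable_add:
  assumes "(\<lambda>i. (cmod (c i))\<^sup>2) summable_on UNIV" "(\<lambda>i. (cmod (d i))\<^sup>2) summable_on UNIV"
  shows "(\<lambda>i. (cmod (c i + d i))\<^sup>2) summable_on UNIV"
proof (rule summable_on_comparison_test)
  show "(\<lambda>i. 2 * (cmod (c i))\<^sup>2 + 2 * (cmod (d i))\<^sup>2) summable_on UNIV"
    by (intro summable_on_add summable_on_cmult_right assms)
  fix i
  have "(cmod (c i + d i))\<^sup>2 \<le> (cmod (c i) + cmod (d i))\<^sup>2"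
    by (intro power_mono norm_triangle_ineq) simp
  also have "\<dots> \<le> 2 * (cmod (c i))\<^sup>2 + 2 * (cmod (d i))\<^sup>2"
    using sum_squares_bound[of "cmod (c i)" "cmod (d i)"] by (simp add: power2_sum)
  finally show "(cmod (c i + d i))\<^sup>2 \<le> 2 * (cmod (c i))\<^sup>2 + 2 * (cmod (d i))\<^sup>2" .
qed simp

lemma coord_mult_summable: "(\<lambda>i. coord c i * cnj (coord d i)) summable_on UNIV"
  by (rule Infinite_Sum.abs_summable_summable, rule Infinite_Sum.abs_summable_product)
    (use coord_summable[of c] coord_summable[of d] in \<open>simp_all add: norm_mult power2_eq_square\<close>)

instantiation ell2 :: (type) real_vector
begin

definition zero_ell2_def: "0 = Abs_ell2 (\<lambda>_. 0)"
definition plus_ell2_def: "c + d = Abs_ell2 (\<lambda>i. coord c i + coord d i)"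
definition uminus_ell2_def: "- c = Abs_ell2 (\<lambda>i. - coord c i)"
definition minus_ell2_def: "c - d = Abs_ell2 (\<lambda>i. coord c i - coord d i)"
definition scaleR_ell2_def: "r *\<^sub>R c = Abs_ell2 (\<lambda>i. complex_of_real r * coord c i)"

lemma coord_zero: "coord 0 i = 0"
  by (simp add: zero_ell2_def coord_Abs)

lemma coord_plus: "coord (c + d) i = coord c i + coord d i"
  by (simp add: plus_ell2_def coord_Abs sq_summable_add coord_summable)

lemma coord_uminus: "coord (- c) i = - coord c i"
  by (simp add: uminus_ell2_def coord_Abs coord_summable)

lemma coord_minus: "coord (c - d) i = coord c i - coord d i"
  using sq_summable_add[OF coord_summable[of c] coord_summable[of "- d"]]
  by (simp add: minus_ell2_def coord_Abs coord_uminus)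

lemma coord_scaleR: "coord (r *\<^sub>R c) i = complex_of_real r * coord c i"
  unfolding scaleR_ell2_def by (subst coord_Abs) (simp_all only: sq_summable_mult coord_summable)

lemmas coord_simps = coord_zero coord_plus coord_uminus coord_minus coord_scaleR

instance
  by standard (rule ell2_eqI, simp add: coord_simps algebra_simps)+

end

lemma coord_mult_self:
  "((\<lambda>i. coord c i * cnj (coord c i)) has_sum
    complex_of_real (\<Sum>\<^sub>\<infinity>i. (cmod (coord c i))\<^sup>2)) UNIV"
proof -
  have "((\<lambda>i. complex_of_real ((cmod (coord c i))\<^sup>2)) has_sum
      complex_of_real (\<Sum>\<^sub>\<infinity>i. (cmod (coord c i))\<^sup>2)) UNIV"
    by (intro has_sum_of_real has_sum_infsum coord_summable)
  then show ?thesis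
    by (simp only: complex_norm_square)
qed

instantiation ell2 :: (type) real_inner
begin

definition inner_ell2_def: "inner c d = Re (\<Sum>\<^sub>\<infinity>i. coord c i * cnj (coord d i))"
definition norm_ell2_def: "norm c = sqrt (inner c (c :: 'a ell2))"
definition sgn_ell2_def: "sgn c = c /\<^sub>R norm (c :: 'a ell2)"
definition dist_ell2_def: "dist c d = norm (c - d :: 'a ell2)"
definition uniformity_ell2_def [code del]:
  "(uniformity :: ('a ell2 \<times> 'a ell2) filter) =
    (INF e\<in>{0 <..}. principal {(x, y). dist x y < e})"
definition open_ell2_def [code del]:
  "open (S :: 'a ell2 set) \<longleftrightarrow>
    (\<forall>x\<in>S. \<forall>\<^sub>F (x', y) in uniformity. x' = x \<longrightarrow> y \<in> S)"

lemma inner_self_ell2: "inner c c = (\<Sum>\<^sub>\<infinity>i. (cmod (coord c i))\<^sup>2)"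
  by (simp only: inner_ell2_def infsumI[OF coord_mult_self] Re_complex_of_real)

instance
proof
  fix x y z :: "'a ell2" and r :: real
  show "inner x y = inner y x"
    unfolding inner_ell2_def
    by (subst cnj.simps(1)[symmetric], subst infsum_cnj[symmetric]) (simp add: mult.commute)
  show "inner (x + y) z = inner x z + inner y z"
    by (simp add: inner_ell2_def coord_simps ring_distribs infsum_add coord_mult_summable)
  show "inner (r *\<^sub>R x) y = r * inner x y"
    by (simp add: inner_ell2_def coord_simps mult.assoc infsum_cmult_right')
  show "0 \<le> inner x x"
    by (simp add: inner_self_ell2 infsum_nonneg)
  show "inner x x = 0 \<longleftrightarrow> x = 0"
  proof
    assume 0: "inner x x = 0"
    show "x = 0"
    proof (rule ell2_eqI)
      fix i
      have "(cmod (coord x i))\<^sup>2 \<le> inner x x"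
        using finite_sum_le_infsum[OF coord_summable[of x], of "{i}"] by (simp add: inner_self_ell2)
      then show "coord x i = coord 0 i" using 0 by (simp add: coord_zero)
    qed
  qed (simp add: inner_self_ell2 coord_zero)
qed (rule norm_ell2_def sgn_ell2_def dist_ell2_def uniformity_ell2_def open_ell2_def)+

end

lemma norm_sq_ell2: "(norm c)\<^sup>2 = (\<Sum>\<^sub>\<infinity>i. (cmod (coord c i))\<^sup>2)"
  by (simp add: power2_norm_eq_inner inner_self_ell2)

lemma sum_coord_le_norm:
  assumes "finite F"
  shows "(\<Sum>i\<in>F. (cmod (coord c i))\<^sup>2) \<le> (norm c)\<^sup>2"
  unfolding norm_sq_ell2 by (rule finite_sum_le_infsum[OF coord_summable assms]) auto

lemma coord_le_norm: "cmod (coord c i) \<le> norm c"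
  by (rule power2_le_imp_le) (use sum_coord_le_norm[of "{i}" c] in auto)

instance ell2 :: (type) complete_space
proof
  fix X :: "nat \<Rightarrow> 'a ell2"
  have dist: "dist x y = norm (x - y)" for x y :: "'a ell2" by (rule dist_norm)
  assume "Cauchy X"
  have X: "\<exists>N. \<forall>m\<ge>N. \<forall>n\<ge>N. norm (X m - X n) < e" if "e > 0" for e
    using CauchyD[OF \<open>Cauchy X\<close> that] by blast
  have "\<exists>l. (\<lambda>n. coord (X n) i) \<longlonglongrightarrow> l" for i
  proof -
    have "Cauchy (\<lambda>n. coord (X n) i)"
    proof (rule metric_CauchyI)
      fix e :: real assume "e > 0"
      then obtain N where N: "\<forall>m\<ge>N. \<forall>n\<ge>N. norm (X m - X n) < e" using X by blast
      show "\<exists>M. \<forall>m\<ge>M. \<forall>n\<ge>M. dist (coord (X m) i) (coord (X n) i) < e"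
      proof (intro exI allI impI)
        fix m n assume "m \<ge> N" "n \<ge> N"
        then have "norm (X m - X n) < e" using N by blast
        then show "dist (coord (X m) i) (coord (X n) i) < e"
          using coord_le_norm[of "X m - X n" i] by (simp add: dist_norm coord_minus)
      qed
    qed
    then show ?thesis by (simp add: Cauchy_convergent_iff convergent_def)
  qed
  then obtain l where l: "\<And>i. (\<lambda>n. coord (X n) i) \<longlonglongrightarrow> l i" by metis
  have bound: "\<exists>N. \<forall>m\<ge>N. \<forall>F. finite F \<longrightarrow> (\<Sum>i\<in>F. (cmod (coord (X m) i - l i))\<^sup>2) \<le> e\<^sup>2"
    if e: "e > 0" for e
  proof -
    obtain N where N: "\<And>m n. m \<ge> N \<Longrightarrow> n \<ge> N \<Longrightarrow> norm (X m - X n) < e" using X[OF e] by blast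
    have "(\<Sum>i\<in>F. (cmod (coord (X m) i - l i))\<^sup>2) \<le> e\<^sup>2" if m: "m \<ge> N" and F: "finite F" for m F
    proof (rule tendsto_upperbound)
      show "(\<lambda>n. \<Sum>i\<in>F. (cmod (coord (X m) i - coord (X n) i))\<^sup>2)
          \<longlonglongrightarrow> (\<Sum>i\<in>F. (cmod (coord (X m) i - l i))\<^sup>2)"
        by (intro tendsto_intros l)
      have "(\<Sum>i\<in>F. (cmod (coord (X m) i - coord (X n) i))\<^sup>2) \<le> e\<^sup>2" if "n \<ge> N" for n
      proof -
        have "(\<Sum>i\<in>F. (cmod (coord (X m) i - coord (X n) i))\<^sup>2) \<le> (norm (X m - X n))\<^sup>2"
          using sum_coord_le_norm[OF F, of "X m - X n"] by (simp add: coord_minus)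
        also have "\<dots> \<le> e\<^sup>2"
          using N[OF m that] by (intro power_mono) auto
        finally show ?thesis .
      qed
      then show "\<forall>\<^sub>F n in sequentially.
          (\<Sum>i\<in>F. (cmod (coord (X m) i - coord (X n) i))\<^sup>2) \<le> e\<^sup>2"
        by (auto simp: eventually_sequentially)
    qed simp
    then show ?thesis by blast
  qed
  have summ: "(\<lambda>i. (cmod (coord (X m) i - l i))\<^sup>2) summable_on UNIV"
    if "\<forall>F. finite F \<longrightarrow> (\<Sum>i\<in>F. (cmod (coord (X m) i - l i))\<^sup>2) \<le> e" for m e
    by (rule nonneg_bdd_above_summable_on) (use that in \<open>auto simp: bdd_above_def\<close>)
  obtain N where "\<forall>F. finite F \<longrightarrow> (\<Sum>i\<in>F. (cmod (coord (X N) i - l i))\<^sup>2) \<le> 1\<^sup>2"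
    using bound[of 1] by auto
  from sq_summable_add[OF coord_summable[of "X N"] sq_summable_mult[OF summ[OF this], of "-1"]]
  have L: "coord (Abs_ell2 l) = l" by (intro coord_Abs) simp
  have "X \<longlonglongrightarrow> Abs_ell2 l"
    unfolding tendsto_iff
  proof (intro allI impI)
    fix e :: real assume e: "e > 0"
    obtain N where N: "\<And>m. m \<ge> N \<Longrightarrow>
        \<forall>F. finite F \<longrightarrow> (\<Sum>i\<in>F. (cmod (coord (X m) i - l i))\<^sup>2) \<le> (e / 2)\<^sup>2"
      using bound[of "e / 2"] e by auto
    have "dist (X m) (Abs_ell2 l) < e" if m: "m \<ge> N" for m
    proof -
      have "(norm (X m - Abs_ell2 l))\<^sup>2 \<le> (e / 2)\<^sup>2"
        unfolding norm_sq_ell2 coord_minus L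
        using N[OF m] by (intro infsum_le_finite_sums summ[OF N[OF m]]) auto
      then have "norm (X m - Abs_ell2 l) \<le> e / 2"
        by (rule power2_le_imp_le) (use e in auto)
      then show ?thesis using e by (simp add: dist)
    qed
    then show "\<forall>\<^sub>F m in sequentially. dist (X m) (Abs_ell2 l) < e"
      by (auto simp: eventually_sequentially)
  qed
  then show "convergent X" by (auto simp: convergent_def)
qed

instantiation ell2 :: (type) complex_hilbert_space
begin

definition scaleC_ell2_def: "a *\<^sub>C c = Abs_ell2 (\<lambda>i. a * coord c i)"
definition cinner_ell2_def: "cinner c d = (\<Sum>\<^sub>\<infinity>i. coord c i * cnj (coord d i))"

lemma coord_scaleC: "coord (a *\<^sub>C c) i = a * coord c i"
  unfolding scaleC_ell2_def by (subst coord_Abs) (simp_all only: sq_summable_mult coord_summable)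

instance
proof
  fix x y z :: "'a ell2" and a b :: complex and r :: real
  show "a *\<^sub>C (x + y) = a *\<^sub>C x + a *\<^sub>C y" "(a + b) *\<^sub>C x = a *\<^sub>C x + b *\<^sub>C x"
    "a *\<^sub>C b *\<^sub>C x = (a * b) *\<^sub>C x" "r *\<^sub>R x = complex_of_real r *\<^sub>C x"
    by (rule ell2_eqI, simp add: coord_scaleC coord_simps algebra_simps)+
  show "cinner (x + y) z = cinner x z + cinner y z"
    by (simp add: cinner_ell2_def coord_simps ring_distribs infsum_add coord_mult_summable)
  show "cinner (a *\<^sub>C x) y = a * cinner x y"
    by (simp add: cinner_ell2_def coord_scaleC mult.assoc infsum_cmult_right')
  show "cinner x y = cnj (cinner y x)"
    unfolding cinner_ell2_def by (subst infsum_cnj[symmetric]) (simp add: mult.commute)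
  show "inner x y = Re (cinner x y)"
    by (simp add: inner_ell2_def cinner_ell2_def)
qed

end


section \<open>Bounded operators\<close>

definition bounded_clinear :: "('a::complex_hilbert_space \<Rightarrow> 'b::complex_hilbert_space) \<Rightarrow> bool" where
  "bounded_clinear T \<longleftrightarrow> bounded_linear T \<and> (\<forall>a x. T (a *\<^sub>C x) = a *\<^sub>C T x)"

definition cadjoint ::
    "('a::complex_hilbert_space \<Rightarrow> 'b::complex_hilbert_space) \<Rightarrow> 'b \<Rightarrow> 'a" where
  "cadjoint T = (THE S. \<forall>x y. cinner (T x) y = cinner x (S y))"

definition kernel :: "('a::complex_hilbert_space \<Rightarrow> 'b::complex_hilbert_space) \<Rightarrow> 'a set" where
  "kernel T = {x. T x = 0}"

definition orth_compl :: "'a::complex_hilbert_space set \<Rightarrow> 'a set" where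
  "orth_compl S = {x. \<forall>y\<in>S. cinner x y = 0}"

text \<open>The Moore-Penrose pseudo-inverse; meaningful only for bounded operators with closed range.\<close>

definition pinv :: "('a::complex_hilbert_space \<Rightarrow> 'b::complex_hilbert_space) \<Rightarrow> 'b \<Rightarrow> 'a" where
  "pinv T = (THE X. bounded_clinear X \<and> kernel X = orth_compl (range T) \<and>
     range X = orth_compl (kernel T) \<and> T \<circ> X \<circ> T = T)"


section \<open>Bessel sequences and frames\<close>

text \<open>In the following definitions \<open>K\<close> is a closed subspace, regarded as a Hilbert space of
  its own; \<open>K = UNIV\<close> is the whole space. Families are indexed by a whole type.\<close>

definition bessel_on :: "'a::complex_hilbert_space set \<Rightarrow> ('i \<Rightarrow> 'a) \<Rightarrow> bool" where
  "bessel_on K \<phi> \<longleftrightarrow> range \<phi> \<subseteq> K \<and>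
     (\<exists>B>0. \<forall>f\<in>K. (\<lambda>i. (cmod (cinner f (\<phi> i)))\<^sup>2) summable_on UNIV \<and>
       (\<Sum>\<^sub>\<infinity>i. (cmod (cinner f (\<phi> i)))\<^sup>2) \<le> B * (norm f)\<^sup>2)"

definition frame_on :: "'a::complex_hilbert_space set \<Rightarrow> ('i \<Rightarrow> 'a) \<Rightarrow> bool" where
  "frame_on K \<phi> \<longleftrightarrow> bessel_on K \<phi> \<and>
     (\<exists>A>0. \<forall>f\<in>K. A * (norm f)\<^sup>2 \<le> (\<Sum>\<^sub>\<infinity>i. (cmod (cinner f (\<phi> i)))\<^sup>2))"

definition synthesis :: "('i \<Rightarrow> 'a::complex_hilbert_space) \<Rightarrow> 'i ell2 \<Rightarrow> 'a" where
  "synthesis \<phi> c = (\<Sum>\<^sub>\<infinity>i. coord c i *\<^sub>C \<phi> i)"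

definition analysis :: "('i \<Rightarrow> 'a::complex_hilbert_space) \<Rightarrow> 'a \<Rightarrow> 'i ell2" where
  "analysis \<phi> f = Abs_ell2 (\<lambda>i. cinner f (\<phi> i))"

definition frame_operator :: "('i \<Rightarrow> 'a::complex_hilbert_space) \<Rightarrow> 'a \<Rightarrow> 'a" where
  "frame_operator \<phi> = synthesis \<phi> \<circ> analysis \<phi>"

definition canonical_dual ::
    "'a::complex_hilbert_space set \<Rightarrow> ('i \<Rightarrow> 'a) \<Rightarrow> 'i \<Rightarrow> 'a" where
  "canonical_dual K \<phi> i = inv_into K (frame_operator \<phi>) (\<phi> i)"

text \<open>\<open>\<phi>\<close> itself need not lie in \<open>V\<close>.\<close>

definition dual_on ::
    "'a::complex_hilbert_space set \<Rightarrow> ('i \<Rightarrow> 'a) \<Rightarrow> ('i \<Rightarrow> 'a) \<Rightarrow> bool" where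
  "dual_on V \<phi> \<phi>' \<longleftrightarrow> bessel_on V \<phi>' \<and>
     (\<forall>f\<in>V. ((\<lambda>i. cinner f (\<phi> i) *\<^sub>C \<phi>' i) has_sum f) UNIV)"

definition cross_gram ::
    "('a::complex_hilbert_space \<Rightarrow> 'b::complex_hilbert_space) \<Rightarrow> ('i \<Rightarrow> 'b) \<Rightarrow> ('i \<Rightarrow> 'a) \<Rightarrow>
      'i ell2 \<Rightarrow> 'i ell2" where
  "cross_gram U \<phi> \<psi> = analysis \<phi> \<circ> U \<circ> synthesis \<psi>"

definition unit_ell2 :: "'i \<Rightarrow> 'i ell2" where
  "unit_ell2 j = Abs_ell2 (\<lambda>i. if i = j then 1 else 0)"

lemma coord_unit_ell2: "coord (unit_ell2 j) i = (if i = j then 1 else 0)"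
proof -
  have "(\<lambda>i. (cmod (if i = j then 1 else 0))\<^sup>2) summable_on UNIV \<longleftrightarrow>
      (\<lambda>i. (cmod (if i = j then 1 else 0))\<^sup>2) summable_on {j}"
    by (rule summable_on_cong_neutral) auto
  then show ?thesis
    by (simp add: unit_ell2_def coord_Abs)
qed

text \<open>The matrix of the operator \<^const>\<open>cross_gram\<close> has the entries \<open>\<langle>U \<psi>\<^sub>j, \<phi>\<^sub>i\<rangle>\<close>.\<close>

lemma cross_gram_entry:
  fixes U :: "'a::complex_hilbert_space \<Rightarrow> 'b::complex_hilbert_space"
  assumes "bessel_on UNIV \<phi>"
  shows "cinner (cross_gram U \<phi> \<psi> (unit_ell2 j)) (unit_ell2 i) = cinner (U (\<psi> j)) (\<phi> i)"
proof -
  have zero: "0 *\<^sub>C x = 0" for x :: 'a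
    using scaleR_scaleC[of 0 x] by simp
  have one: "1 *\<^sub>C x = x" for x :: 'a
    using scaleR_scaleC[of 1 x] by simp
  have "synthesis \<psi> (unit_ell2 j) = (\<Sum>\<^sub>\<infinity>i\<in>{j}. coord (unit_ell2 j) i *\<^sub>C \<psi> i)"
    unfolding synthesis_def by (rule infsum_cong_neutral) (auto simp: coord_unit_ell2 zero)
  then have s: "synthesis \<psi> (unit_ell2 j) = \<psi> j"
    by (simp add: coord_unit_ell2 one)
  have a: "coord (analysis \<phi> f) i = cinner f (\<phi> i)" for f
    using assms by (auto simp: analysis_def bessel_on_def coord_Abs)
  have "cinner d (unit_ell2 i) = (\<Sum>\<^sub>\<infinity>k\<in>{i}. coord d k * cnj (coord (unit_ell2 i) k))" for d
    unfolding cinner_ell2_def by (rule infsum_cong_neutral) (auto simp: coord_unit_ell2)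
  then have "cinner d (unit_ell2 i) = coord d i" for d
    by (simp add: coord_unit_ell2)
  then show ?thesis
    by (simp add: cross_gram_def s a)
qed

end

theory Submission
  imports Defs
begin

text \<open>
  Write \<open>T_\<phi>\<close> for the synthesis operator of a Bessel sequence, so that its adjoint \<open>T_\<phi>*\<close> is the
  analysis operator, and \<open>S_\<psi> = T_\<psi> T_\<psi>*\<close>. Let \<open>G = T_\<phi>* U T_\<psi>\<close>, let \<open>\<phi>'\<close> be any dual of \<open>\<phi>\<close> on
  \<open>R(U)\<close>, and let \<open>X = T_\<psi>* S_\<psi>\<^sup>-\<^sup>1 U\<dagger> T_\<phi>'\<close> be the candidate built from the canonical dual of \<open>\<psi>\<close>.
  The pseudo-inverse of \<open>G\<close> is characterised by a kernel, a range and an equation.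

  The equation \<open>G X G = G\<close> holds for every dual, because \<open>T_\<psi> T_\<psi>* S_\<psi>\<^sup>-\<^sup>1\<close> is the identity,
  \<open>T_\<phi>' T_\<phi>*\<close> is the identity on \<open>R(U)\<close>, and \<open>U U\<dagger> U = U\<close>. The range of \<open>X\<close> is
  \<open>T_\<psi>* S_\<psi>\<^sup>-\<^sup>1 R(U*)\<close>, whereas the orthogonal complement of the kernel of \<open>G\<close> is
  \<open>R(G*) = T_\<psi>* R(U*)\<close>, since \<open>T_\<phi>\<close> is onto. As \<open>T_\<psi>*\<close> is injective, the two agree exactly when
  \<open>S_\<psi>\<close> maps \<open>R(U*)\<close> onto itself; this condition does not involve \<open>\<phi>'\<close>. The kernel of \<open>X\<close> is that of
  \<open>T_\<phi>'\<close>, and it must equal the kernel of \<open>U* T_\<phi>\<close>, the orthogonal complement of \<open>R(G)\<close>. This is a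
  condition that does not involve \<open>\<psi>\<close>, and the canonical dual of \<open>UU\<dagger>\<phi>\<close> satisfies it: there
  \<open>T_\<phi>' = R U U\<dagger> T_\<phi>\<close> with \<open>R\<close> injective on \<open>R(U)\<close>, and \<open>U U\<dagger>\<close> is the orthogonal projection onto
  \<open>R(U)\<close>, whose kernel is that of \<open>U*\<close>. The lemma \<open>pinv_cross_gram_dual_iff\<close> combines these
  observations; it yields the first half at once.

  The second half is the first half for \<open>U*\<close> with \<open>\<phi>\<close> and \<open>\<psi>\<close> interchanged, read through adjoints:
  \<open>G* = T_\<psi>* U* T_\<phi>\<close>, taking pseudo-inverses commutes with taking adjoints, and
  \<open>U* (U*)\<dagger> = (U\<dagger> U)* = U\<dagger> U\<close>.

  The background is elementary Hilbert space theory. Nested bounded closed convex sets have a common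
  point (\<open>nested_convex_inter_nonempty\<close>); this yields orthogonal projections, hence the Riesz
  representation and adjoints, and together with the Baire category theorem the boundedness of
  the pseudo-inverse of an operator with closed range. Pseudo-inverses are then handled through the
  four Penrose equations, which are symmetric under adjoints.
\<close>

section \<open>Convexity in a complete real inner product space\<close>

lemma LIMSEQ_inverse_Suc: "(\<lambda>n. 1 / (real n + 1)) \<longlonglongrightarrow> 0"
  using LIMSEQ_inverse_real_of_nat by (simp add: inverse_eq_divide add.commute)

text \<open>Nearly minimal elements of the sets form a Cauchy sequence: their squared distance is controlled
  by the parallelogram law, because midpoints stay in the set and the minimal norms converge.
  This plays the part of weak compactness of bounded closed convex sets.\<close>

lemma nested_convex_inter_nonempty:
  fixes C :: "nat \<Rightarrow> 'a::{real_inner,complete_space} set"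
  assumes closed: "\<And>n. closed (C n)" and conv: "\<And>n. convex (C n)"
    and ne: "\<And>n. C n \<noteq> {}" and dec: "\<And>m n. m \<le> n \<Longrightarrow> C n \<subseteq> C m"
    and bdd: "bounded (C 0)"
  shows "\<exists>x. \<forall>n. x \<in> C n"
proof -
  define d where "d n = (INF x\<in>C n. (norm x)\<^sup>2)" for n
  have below: "bdd_below ((\<lambda>x. (norm x)\<^sup>2) ` C n)" for n
    by (intro bdd_belowI[of _ 0]) auto
  have d_le: "d n \<le> (norm x)\<^sup>2" if "x \<in> C n" for n x
    unfolding d_def using below that by (rule cINF_lower)
  have d_mono: "d m \<le> d n" if "m \<le> n" for m n
    unfolding d_def by (rule cINF_superset_mono[OF ne below dec[OF that]]) simp
  obtain B where B: "\<And>x. x \<in> C 0 \<Longrightarrow> norm x \<le> B"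
    using bdd by (auto simp: bounded_iff)
  have d_bound: "d n \<le> B\<^sup>2" for n
  proof -
    obtain x where x: "x \<in> C n" using ne by blast
    then have "norm x \<le> B" using dec[of 0 n] B by blast
    then have "(norm x)\<^sup>2 \<le> B\<^sup>2" by (simp add: power_mono)
    then show ?thesis using d_le[OF x] by simp
  qed
  obtain L where L: "d \<longlonglongrightarrow> L" and dL: "\<And>n. d n \<le> L"
    using incseq_convergent[of d "B\<^sup>2"] d_mono d_bound by (auto simp: incseq_def)
  have "\<exists>x\<in>C n. (norm x)\<^sup>2 < d n + 1 / (real n + 1)" for n
  proof -
    have "(INF x\<in>C n. (norm x)\<^sup>2) < d n + 1 / (real n + 1)"
      by (simp add: d_def add_pos_nonneg)
    then show ?thesis using ne below by (subst (asm) cINF_less_iff) auto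
  qed
  then obtain x where x: "\<And>n. x n \<in> C n" and xd: "\<And>n. (norm (x n))\<^sup>2 < d n + 1 / (real n + 1)"
    by metis
  \<comment> \<open>The bound on the squared distance of two elements beyond index \<open>n\<close> that the
    parallelogram law gives.\<close>
  define e where "e n = 2 * (L - d n) + 4 / (real n + 1)" for n
  have close: "(norm (x m - x n))\<^sup>2 \<le> e n" if "n \<le> m" for m n
  proof -
    let ?y = "(1/2) *\<^sub>R x m + (1/2) *\<^sub>R x n"
    have "?y \<in> C n"
      using conv[of n] x[of n] x[of m] dec[OF that] by (intro convexD) auto
    then have "d n \<le> (norm ?y)\<^sup>2" by (rule d_le)
    moreover have "(norm (x m - x n))\<^sup>2 = 2 * (norm (x m))\<^sup>2 + 2 * (norm (x n))\<^sup>2 - 4 * (norm ?y)\<^sup>2"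
      by (simp add: power2_norm_eq_inner algebra_simps inner_commute)
    moreover have "1 / (real m + 1) \<le> 1 / (real n + 1)" 
      using that by (simp add: frac_le)
    ultimately show ?thesis using xd[of m] xd[of n] dL[of m] by (simp add: e_def)
  qed
  have e0: "e \<longlonglongrightarrow> 0"
  proof -
    have "(\<lambda>n. 4 / (real n + 1)) \<longlonglongrightarrow> 0"
      using tendsto_mult_left[OF LIMSEQ_inverse_Suc, of 4] by simp
    from tendsto_add[OF tendsto_mult_left[OF tendsto_diff[OF tendsto_const L], of 2 L] this]
    show ?thesis by (simp add: e_def[abs_def])
  qed
  have "Cauchy x"
  proof (rule CauchyI')
    fix r :: real assume r: "r > 0"
    then have "\<forall>\<^sub>F n in sequentially. e n < r\<^sup>2"
      using order_tendstoD(2)[OF e0, of "r\<^sup>2"] by simp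
    then obtain N where N: "\<And>n. n \<ge> N \<Longrightarrow> e n < r\<^sup>2" by (auto simp: eventually_sequentially)
    have "norm (x m - x n) < r" if "m \<ge> N" "n > m" for m n
    proof -
      have "(norm (x n - x m))\<^sup>2 < r\<^sup>2" using close[of m n] N[of m] that by simp
      then show ?thesis using r by (simp add: norm_minus_commute power2_less_imp_less)
    qed
    then show "\<exists>M. \<forall>m\<ge>M. \<forall>n>m. dist (x m) (x n) < r"
      by (auto simp: dist_norm)
  qed
  then obtain l where l: "x \<longlonglongrightarrow> l" using Cauchy_convergent convergent_def by blast
  have "l \<in> C n" for n
  proof (rule Lim_in_closed_set[OF closed _ _ l])
    show "\<forall>\<^sub>F m in sequentially. x m \<in> C n"
      using x dec by (auto simp: eventually_sequentially intro!: exI[of _ n])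
  qed simp
  then show ?thesis by blast
qed

text \<open>The nearest points are the common points of \<open>C\<close> and of the balls around \<open>a\<close> whose radii decrease
  to the distance.\<close>

lemma closest_point_in_closed_convex:
  fixes C :: "'a::{real_inner,complete_space} set"
  assumes "closed C" "convex C" "C \<noteq> {}"
  shows "\<exists>p\<in>C. \<forall>c\<in>C. dist a p \<le> dist a c"
proof -
  define \<delta> where "\<delta> = (INF c\<in>C. dist a c)"
  have below: "bdd_below (dist a ` C)" by (intro bdd_belowI[of _ 0]) auto
  have \<delta>: "\<delta> \<le> dist a c" if "c \<in> C" for c
    unfolding \<delta>_def using below that by (rule cINF_lower)
  have "\<exists>x. \<forall>n. x \<in> C \<inter> cball a (\<delta> + 1 / (real n + 1))"
  proof (rule nested_convex_inter_nonempty)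
    fix n
    have "(INF c\<in>C. dist a c) < \<delta> + 1 / (real n + 1)" by (simp add: \<delta>_def add_pos_nonneg)
    then obtain c where "c \<in> C" "dist a c < \<delta> + 1 / (real n + 1)"
      using assms(3) below by (subst (asm) cINF_less_iff) auto
    then show "C \<inter> cball a (\<delta> + 1 / (real n + 1)) \<noteq> {}"
      by (auto intro!: exI[of _ c])
  next
    fix m n :: nat assume "m \<le> n"
    then have "1 / (real n + 1) \<le> 1 / (real m + 1)" by (simp add: frac_le)
    then show "C \<inter> cball a (\<delta> + 1 / (real n + 1)) \<subseteq> C \<inter> cball a (\<delta> + 1 / (real m + 1))"
      by auto
  qed (use assms in \<open>auto intro: convex_Int\<close>)
  then obtain p where p: "p \<in> C" "\<And>n. dist a p \<le> \<delta> + 1 / (real n + 1)" by auto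
  have "(\<lambda>n. \<delta> + 1 / (real n + 1)) \<longlonglongrightarrow> \<delta>"
    using tendsto_add[OF tendsto_const LIMSEQ_inverse_Suc, of \<delta>] by simp
  then have "dist a p \<le> \<delta>" by (rule tendsto_lowerbound) (use p in auto)
  then show ?thesis using p(1) \<delta> by force
qed

text \<open>The nearest point works: if \<open>a - p\<close> had a component along some \<open>m\<close> in \<open>M\<close>, moving \<open>p\<close> in that
  direction would bring it closer to \<open>a\<close>.\<close>

lemma orthogonal_projection_exists:
  fixes M :: "'a::{real_inner,complete_space} set"
  assumes "closed M" "subspace M"
  shows "\<exists>p\<in>M. \<forall>m\<in>M. inner (a - p) m = 0"
proof -
  obtain p where p: "p \<in> M" "\<And>c. c \<in> M \<Longrightarrow> dist a p \<le> dist a c"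
    using closest_point_in_closed_convex[OF assms(1) subspace_imp_convex[OF assms(2)], of a]
      subspace_0[OF assms(2)] by blast
  have "inner (a - p) m = 0" if m: "m \<in> M" for m
  proof (cases "m = 0")
    case False
    \<comment> \<open>The step that minimises the distance from \<open>a\<close> to \<open>p + t m\<close>.\<close>
    define t where "t = inner (a - p) m / inner m m"
    have "p + t *\<^sub>R m \<in> M" using p m assms(2) by (simp add: subspace_add subspace_scale)
    then have "norm (a - p) \<le> norm (a - p - t *\<^sub>R m)"
      using p(2) by (fastforce simp: dist_norm diff_diff_eq)
    then have "inner (a - p) (a - p) \<le> inner (a - p - t *\<^sub>R m) (a - p - t *\<^sub>R m)"
      by (simp add: norm_eq_sqrt_inner)
    also have "\<dots> = inner (a - p) (a - p) - 2 * t * inner (a - p) m + t * t * inner m m"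
      by (simp add: inner_diff_left inner_diff_right inner_commute algebra_simps)
    also have "\<dots> = inner (a - p) (a - p) - (inner (a - p) m)\<^sup>2 / inner m m"
      using False by (simp add: t_def power2_eq_square)
    finally have "(inner (a - p) m)\<^sup>2 / inner m m \<le> 0" by simp
    then show ?thesis using False by (simp add: divide_le_0_iff)
       (metis inner_ge_zero inner_eq_zero_iff order_antisym)
  qed simp
  then show ?thesis using p(1) by blast
qed

text \<open>A quantitative open mapping theorem. The usual successive approximation is avoided: in an inner
  product space the image of a closed ball is itself closed, by the nested convex sets lemma, so the
  Baire category theorem directly gives a ball of the range inside such an image.\<close>

lemma closed_range_imp_bounded_preimages:
  fixes T :: "'a::{real_inner,complete_space} \<Rightarrow> 'b::{real_normed_vector,complete_space}"
  assumes T: "bounded_linear T" and cl: "closed (range T)"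
  shows "\<exists>C>0. \<forall>y\<in>range T. \<exists>x. T x = y \<and> norm x \<le> C * norm y"
proof -
  interpret T: bounded_linear T by fact
  define W where "W = range T"
  define E where "E n = T ` cball 0 (real n)" for n :: nat
  \<comment> \<open>Preimages, of norm at most \<open>n\<close>, of shrinking balls around a limit point \<open>y\<close> of \<open>E n\<close>
    are nested convex sets; a common point is a preimage of \<open>y\<close>.\<close>
  have Ecl: "closed (E n)" for n
    unfolding closed_sequential_limits
  proof (intro allI impI, elim conjE)
    fix s y assume s: "\<forall>k. s k \<in> E n" and y: "s \<longlonglongrightarrow> y"
    have "\<exists>x. \<forall>k. x \<in> cball 0 (real n) \<inter> T -` cball y (1 / (real k + 1))"
    proof (rule nested_convex_inter_nonempty)
      fix k
      show "closed (cball 0 (real n) \<inter> T -` cball y (1 / (real k + 1)))"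
        by (intro closed_Int closed_cball closed_vimage T.continuous_on continuous_on_id)
      show "convex (cball 0 (real n) \<inter> T -` cball y (1 / (real k + 1)))"
        by (intro convex_Int convex_cball convex_linear_vimage T.linear)
      have "\<forall>\<^sub>F j in sequentially. dist (s j) y < 1 / (real k + 1)"
        using y by (rule tendstoD) simp
      then obtain j where j: "dist (s j) y < 1 / (real k + 1)"
        using eventually_sequentially by auto
      moreover obtain x where "x \<in> cball 0 (real n)" "s j = T x" using s unfolding E_def by blast
      ultimately have "x \<in> cball 0 (real n) \<inter> T -` cball y (1 / (real k + 1))"
        by (simp add: dist_commute)
      then show "cball 0 (real n) \<inter> T -` cball y (1 / (real k + 1)) \<noteq> {}" by blast
    next
      fix k l :: nat assume "k \<le> l"
      then have "1 / (real l + 1) \<le> 1 / (real k + 1)" by (simp add: frac_le)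
      then show "cball 0 (real n) \<inter> T -` cball y (1 / (real l + 1))
          \<subseteq> cball 0 (real n) \<inter> T -` cball y (1 / (real k + 1))" by auto
    qed (auto intro: bounded_subset[OF bounded_cball])
    then obtain x where x: "x \<in> cball 0 (real n)" "\<And>k. dist y (T x) \<le> 1 / (real k + 1)" by auto
    have "dist y (T x) \<le> 0"
      using LIMSEQ_inverse_Suc by (rule tendsto_lowerbound) (use x in auto)
    then show "y \<in> E n" using x(1) by (auto simp: E_def)
  qed
  have UE: "(\<Union>n. E n) = W"
    unfolding E_def W_def using real_arch_simple by fastforce
  \<comment> \<open>The range is a complete metric space and the union of the closed sets \<open>E n\<close>, so one of them
    has an interior point relative to the range.\<close>
  interpret W: Metric_space W dist
    by unfold_locales (auto simp: dist_commute intro: dist_triangle)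
  have mtop: "openin W.mtopology S \<longleftrightarrow> S \<subseteq> W \<and> (\<forall>x\<in>S. \<exists>r>0. ball x r \<inter> W \<subseteq> S)" for S
    by (fastforce simp: W.openin_mtopology W.mball_def subset_iff)
  have "\<exists>n. W.mtopology interior_of E n \<noteq> {}"
  proof (rule ccontr)
    assume *: "\<nexists>n. W.mtopology interior_of E n \<noteq> {}"
    have "W.mtopology interior_of \<Union>(range E) = {}"
    proof (rule W.metric_Baire_category_alt)
      show "W.mcomplete"
        unfolding W.mcomplete_def
      proof (intro allI impI)
        fix s assume "W.MCauchy s"
        then have s: "range s \<subseteq> W" "Cauchy s"
          by (auto simp: W.MCauchy_def Cauchy_def)
        then obtain l where l: "s \<longlonglongrightarrow> l" using Cauchy_convergent convergent_def by blast
        have "l \<in> W" 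
          using cl s(1) l unfolding W_def[symmetric] by (metis closed_sequentially range_subsetD)
        then show "\<exists>x. limitin W.mtopology s x sequentially"
          using s l by (auto simp: W.limitin_metric tendsto_iff range_subsetD intro!: exI[of _ l])
      qed
      fix S assume "S \<in> range E"
      then obtain n where n: "S = E n" by blast
      have "openin W.mtopology (W - E n)"
        unfolding mtop
      proof (intro conjI ballI)
        fix x assume "x \<in> W - E n"
        then obtain r where "r > 0" "ball x r \<subseteq> - E n"
          using Ecl[of n] by (metis open_contains_ball ComplI DiffE open_Compl)
        then show "\<exists>r>0. ball x r \<inter> W \<subseteq> W - E n" by blast
      qed blast
      then show "closedin W.mtopology S \<and> W.mtopology interior_of S = {}"
        using * n UE by (auto simp: closedin_def)
    qed simp
    then have "W.mtopology interior_of W = {}" by (simp add: UE)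
    moreover have "openin W.mtopology W" by (metis W.topspace_mtopology openin_topspace)
    ultimately show False by (auto simp: interior_of_openin W_def)
  qed
  then obtain n y where "y \<in> W.mtopology interior_of E n" by blast
  then obtain S where S: "openin W.mtopology S" "y \<in> S" "S \<subseteq> E n"
    by (auto simp: interior_of_def)
  then obtain r where r: "r > 0" "ball y r \<inter> W \<subseteq> E n" and yW: "y \<in> W" 
    unfolding mtop by blast
  have Wadd: "u + c *\<^sub>R v \<in> W" if "u \<in> W" "v \<in> W" for u v c
    using that by (auto simp: W_def) (metis T.add T.scaleR rangeI)
  \<comment> \<open>Every vector of norm \<open>r / 2\<close> in the range has a preimage that is a difference of two vectors
    of norm at most \<open>n\<close>.
    The summand \<open>1\<close> only keeps the constant positive when \<open>n = 0\<close>.\<close>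
  define C where "C = 4 * real n / r + 1"
  show ?thesis
  proof (intro exI[of _ C] conjI ballI)
    show "C > 0" using r by (simp add: C_def add_nonneg_pos)
    fix w assume w: "w \<in> range T"
    show "\<exists>x. T x = w \<and> norm x \<le> C * norm w"
    proof (cases "w = 0")
      case True then show ?thesis by (intro exI[of _ 0]) simp
    next
      case False
      define c where "c = r / (2 * norm w)"
      have c: "c > 0" using False r by (simp add: c_def)
      have "y + c *\<^sub>R w \<in> ball y r \<inter> W"
        using Wadd[OF yW] w False r by (simp add: W_def dist_norm c_def)
      then obtain x1 where x1: "norm x1 \<le> n" "T x1 = y + c *\<^sub>R w"
        using r(2) unfolding E_def by fastforce
      have "y \<in> ball y r \<inter> W" using yW r by simp
      then obtain x0 where x0: "norm x0 \<le> n" "T x0 = y" 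
        using r(2) unfolding E_def by fastforce
      have nx: "norm (x1 - x0) \<le> 2 * n" using norm_triangle_ineq4[of x1 x0] x1 x0 by simp
      have "T ((1/c) *\<^sub>R (x1 - x0)) = w"
        using x1 x0 c by (simp add: T.scaleR T.diff)
      moreover have "norm ((1/c) *\<^sub>R (x1 - x0)) \<le> (1/c) * (2 * n)"
        using c mult_left_mono[OF nx, of "1/c"] by simp
      moreover have "(1/c) * (2 * n) \<le> C * norm w"
        using False r by (simp add: c_def C_def field_simps)
      ultimately show ?thesis
        by (intro exI[of _ "(1/c) *\<^sub>R (x1 - x0)"] conjI) (assumption, linarith)
    qed
  qed
qed

section \<open>Elementary facts about the complex inner product\<close>

lemma cinner_add_right: "cinner x (y + z) = cinner x y + cinner x (z::'a::complex_hilbert_space)"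
  by (subst (1 2 3) cinner_commute) (simp add: cinner_add_left)

lemma cinner_scaleC_right: "cinner x (a *\<^sub>C y) = cnj a * cinner x (y::'a::complex_hilbert_space)"
  by (subst (1 2) cinner_commute) (simp add: cinner_scaleC_left)

lemma scaleC_minus1: "(-1) *\<^sub>C x = - (x::'a::complex_hilbert_space)"
  using scaleR_scaleC[of "-1" x] by simp

lemma cinner_zero_left: "cinner 0 (y::'a::complex_hilbert_space) = 0"
  using cinner_add_left[of 0 0 y] by simp

lemma cinner_zero_right: "cinner (y::'a::complex_hilbert_space) 0 = 0"
  using cinner_add_right[of y 0 0] by simp

lemma cinner_minus_left: "cinner (- x) y = - cinner x (y::'a::complex_hilbert_space)"
  using cinner_scaleC_left[of "-1" x y] by (simp add: scaleC_minus1)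

lemma cinner_minus_right: "cinner x (- y) = - cinner x (y::'a::complex_hilbert_space)"
  using cinner_scaleC_right[of x "-1" y] by (simp add: scaleC_minus1)

lemma cinner_diff_left: "cinner (x - y) z = cinner x z - cinner y (z::'a::complex_hilbert_space)"
  using cinner_add_left[of x "- y" z] by (simp add: cinner_minus_left)

lemma cinner_diff_right: "cinner x (y - z) = cinner x y - cinner x (z::'a::complex_hilbert_space)"
  using cinner_add_right[of x y "- z"] by (simp add: cinner_minus_right)

lemmas cinner_simps = cinner_add_left cinner_add_right cinner_diff_left cinner_diff_right
  cinner_minus_left cinner_minus_right cinner_zero_left cinner_zero_right
  cinner_scaleC_left cinner_scaleC_right

lemma cinner_self: "cinner x x = complex_of_real ((norm (x::'a::complex_hilbert_space))\<^sup>2)"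
proof (rule complex_eqI)
  show "Re (cinner x x) = Re (complex_of_real ((norm x)\<^sup>2))"
    by (simp only: Re_complex_of_real power2_norm_eq_inner inner_eq_Re_cinner)
  have "Im (cinner x x) = - Im (cinner x x)" by (subst cinner_commute) simp
  then show "Im (cinner x x) = Im (complex_of_real ((norm x)\<^sup>2))"
    by (simp only: Im_complex_of_real)
qed

lemma cinner_self_eq_0: "cinner x x = 0 \<longleftrightarrow> x = (0::'a::complex_hilbert_space)"
  by (simp add: cinner_self)

lemma norm_scaleC: "norm (a *\<^sub>C x) = cmod a * norm (x::'a::complex_hilbert_space)"
proof -
  have "complex_of_real ((norm (a *\<^sub>C x))\<^sup>2) = cinner (a *\<^sub>C x) (a *\<^sub>C x)"
    by (rule cinner_self[symmetric])
  also have "\<dots> = (a * cnj a) * cinner x x" by (simp add: cinner_simps)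
  also have "\<dots> = complex_of_real ((cmod a)\<^sup>2) * complex_of_real ((norm x)\<^sup>2)"
    by (rule arg_cong2[OF complex_norm_square[symmetric] cinner_self])
  also have "\<dots> = complex_of_real ((cmod a * norm x)\<^sup>2)"
    by (simp add: power_mult_distrib)
  finally have "(norm (a *\<^sub>C x))\<^sup>2 = (cmod a * norm x)\<^sup>2" by (rule of_real_eq_iff[THEN iffD1])
  then show ?thesis by (rule power2_eq_imp_eq) simp_all
qed

lemma cmod_cinner_le: "cmod (cinner x y) \<le> norm x * norm (y::'a::complex_hilbert_space)"
proof (cases "cinner x y = 0")
  case False
  define a where "a = cinner x y"
  \<comment> \<open>A phase that turns the inner product into its modulus, so that the real Cauchy-Schwarz
    inequality applies.\<close>
  define u where "u = cnj a / cmod a"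
  have a: "a \<noteq> 0" using False by (simp add: a_def)
  have "cmod u = 1" using a by (simp add: u_def norm_divide)
  have "cnj a * a = complex_of_real (cmod a) * complex_of_real (cmod a)"
    using complex_norm_square[of a] by (simp add: mult.commute power2_eq_square)
  then have "cinner (u *\<^sub>C x) y = complex_of_real (cmod a)"
    using a by (simp add: cinner_scaleC_left u_def flip: a_def)
  then have "cmod a = inner (u *\<^sub>C x) y" by (simp add: inner_eq_Re_cinner)
  also have "\<dots> \<le> norm (u *\<^sub>C x) * norm y" by (rule norm_cauchy_schwarz)
  finally show ?thesis using \<open>cmod u = 1\<close> by (simp add: norm_scaleC a_def)
qed simp

lemma cinner_eqI: "(\<And>x. cinner x y = cinner x z) \<Longrightarrow> y = (z::'a::complex_hilbert_space)"
  using cinner_self_eq_0[of "y - z"] by (simp add: cinner_simps)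

lemma bounded_linear_cinner_left: "bounded_linear (\<lambda>x. cinner x (y::'a::complex_hilbert_space))"
  by (rule bounded_linear_intro[where K = "norm y"])
    (simp_all add: cinner_simps cmod_cinner_le scaleR_scaleC scaleR_conv_of_real)

section \<open>Closed subspaces, the Riesz representation and adjoints\<close>

text \<open>Closed complex subspaces are the sets onto which there is an orthogonal projection; the operators
  to be projected are complex linear, so closure under real scalars would not suffice.\<close>

definition closed_csubspace :: "'a::complex_hilbert_space set \<Rightarrow> bool" where
  "closed_csubspace M \<longleftrightarrow> closed M \<and> subspace M \<and> (\<forall>a. \<forall>x\<in>M. a *\<^sub>C x \<in> M)"

lemma closed_csubspace_diff: "closed_csubspace M \<Longrightarrow> x \<in> M \<Longrightarrow> y \<in> M \<Longrightarrow> x - y \<in> M"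
  by (simp add: closed_csubspace_def subspace_diff)

lemma closed_csubspace_UNIV: "closed_csubspace UNIV"
  by (simp add: closed_csubspace_def)

lemma orth_compl_commute: "x \<in> orth_compl S \<Longrightarrow> y \<in> S \<Longrightarrow> cinner y x = 0"
  by (subst cinner_commute) (simp add: orth_compl_def)

lemma orth_complD: "x \<in> orth_compl S \<Longrightarrow> y \<in> S \<Longrightarrow> cinner x y = 0"
  by (simp add: orth_compl_def)

lemma orth_complI: "(\<And>y. y \<in> S \<Longrightarrow> cinner x y = 0) \<Longrightarrow> x \<in> orth_compl S"
  by (simp add: orth_compl_def)

lemma orth_compl_Int: "x \<in> S \<Longrightarrow> x \<in> orth_compl S \<Longrightarrow> x = 0"
  using orth_complD cinner_self_eq_0 by blast

lemma closed_csubspace_orth_compl: "closed_csubspace (orth_compl S)"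
proof -
  have "orth_compl S = (\<Inter>y\<in>S. (\<lambda>x. cinner x y) -` {0})" by (auto simp: orth_compl_def)
  moreover have "closed ((\<lambda>x. cinner x y) -` {0})" for y :: 'a
    by (intro closed_vimage closed_singleton linear_continuous_on bounded_linear_cinner_left)
  ultimately have "closed (orth_compl S)" by auto
  then show ?thesis
    unfolding closed_csubspace_def subspace_def
    by (auto simp: orth_compl_def cinner_simps scaleR_scaleC)
qed

text \<open>The real projection is also the complex one, because orthogonality of \<open>a - p\<close> to \<open>\<i> m\<close> for the real
  inner product is the vanishing of the imaginary part of the complex inner product with \<open>m\<close>.\<close>

lemma orthogonal_decomposition:
  assumes M: "closed_csubspace M"
  shows "\<exists>p\<in>M. a - p \<in> orth_compl M"
proof -
  obtain p where p: "p \<in> M" "\<And>m. m \<in> M \<Longrightarrow> inner (a - p) m = 0"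
    using orthogonal_projection_exists[of M a] M by (auto simp: closed_csubspace_def)
  have "cinner (a - p) m = 0" if m: "m \<in> M" for m
  proof (rule complex_eqI)
    show "Re (cinner (a - p) m) = Re 0" using p(2)[OF m] by (simp add: inner_eq_Re_cinner)
    have "\<i> *\<^sub>C m \<in> M" using M m by (simp add: closed_csubspace_def)
    from p(2)[OF this] show "Im (cinner (a - p) m) = Im 0"
      by (simp add: inner_eq_Re_cinner cinner_scaleC_right)
  qed
  then show ?thesis using p(1) by (auto simp: orth_compl_def)
qed

lemma subset_orth_compl_orth_compl: "x \<in> M \<Longrightarrow> x \<in> orth_compl (orth_compl M)"
  by (rule orth_complI) (rule orth_compl_commute)

lemma orth_compl_orth_compl:
  assumes "closed_csubspace M"
  shows "orth_compl (orth_compl M) = M"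
proof
  show "M \<subseteq> orth_compl (orth_compl M)" by (auto intro: subset_orth_compl_orth_compl)
  show "orth_compl (orth_compl M) \<subseteq> M"
  proof
    fix x assume x: "x \<in> orth_compl (orth_compl M)"
    obtain p where p: "p \<in> M" "x - p \<in> orth_compl M" using orthogonal_decomposition[OF assms] by blast
    have "p \<in> orth_compl (orth_compl M)" using p(1) by (rule subset_orth_compl_orth_compl)
    then have "x - p \<in> orth_compl (orth_compl M)"
      using x closed_csubspace_diff[OF closed_csubspace_orth_compl] by blast
    then have "x - p = 0" using p(2) orth_compl_Int by blast
    then show "x \<in> M" using p(1) by simp
  qed
qed

text \<open>Pythagoras.\<close>

lemma norm_orthogonal_le:
  assumes "cinner p (x - p) = 0"
  shows "norm p \<le> norm x" "norm (x - p) \<le> norm (x::'a::complex_hilbert_space)"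
proof -
  have "inner p (x - p) = 0" using assms by (simp add: inner_eq_Re_cinner)
  then have "(norm x)\<^sup>2 = (norm p)\<^sup>2 + (norm (x - p))\<^sup>2"
    using norm_add_Pythagorean[of p "x - p"] by (simp add: orthogonal_def)
  then have "(norm p)\<^sup>2 \<le> (norm x)\<^sup>2" "(norm (x - p))\<^sup>2 \<le> (norm x)\<^sup>2" by auto
  then show "norm p \<le> norm x" "norm (x - p) \<le> norm x"
    by (auto dest: power2_le_imp_le)
qed

text \<open>If \<open>f\<close> does not vanish, its kernel is a closed hyperplane, and a vector orthogonal to it
  represents \<open>f\<close> up to a scalar.\<close>

lemma riesz_representation:
  fixes f :: "'a::complex_hilbert_space \<Rightarrow> complex"
  assumes bl: "bounded_linear f" and scal: "\<And>a x. f (a *\<^sub>C x) = a * f x"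
  shows "\<exists>z. \<forall>x. f x = cinner x z"
proof (cases "\<forall>x. f x = 0")
  case True
  then show ?thesis by (intro exI[of _ 0]) (simp add: cinner_simps)
next
  case False
  then obtain y where y: "f y \<noteq> 0" by blast
  interpret f: bounded_linear f by fact
  define M where "M = f -` {0}"
  have "closed M" unfolding M_def
    by (intro closed_vimage closed_singleton linear_continuous_on bl)
  then have "closed_csubspace M"
    by (simp add: closed_csubspace_def subspace_def M_def f.add f.scaleR scal f.zero)
  then obtain p where p: "p \<in> M" "y - p \<in> orth_compl M" using orthogonal_decomposition by blast
  define u where "u = y - p"
  have fu: "f u = f y" using p(1) by (simp add: u_def M_def f.diff)
  then have u0: "u \<noteq> 0" using y f.zero by auto
  have "f x = cinner x ((cnj (f u) / (norm u)\<^sup>2) *\<^sub>C u)" for x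
  proof -
    have "x - (f x / f u) *\<^sub>C u \<in> M"
      using fu y by (simp add: M_def f.diff scal)
    then have "cinner (x - (f x / f u) *\<^sub>C u) u = 0"
      using p(2) orth_compl_commute unfolding u_def by blast
    then have "cinner x u = (f x / f u) * (norm u)\<^sup>2"
      by (simp add: cinner_simps cinner_self)
    then show ?thesis using u0 fu y by (simp add: cinner_simps)
  qed
  then show ?thesis by blast
qed

lemma bounded_clinearI:
  assumes "\<And>x y. T (x + y) = T x + T y" "\<And>a x. T (a *\<^sub>C x) = a *\<^sub>C T x"
    "\<And>x. norm (T x) \<le> norm x * K"
  shows "bounded_clinear T"
  unfolding bounded_clinear_def
  by (intro conjI bounded_linear_intro[where K = K] allI)
    (use assms in \<open>simp_all add: scaleR_scaleC\<close>)

lemma bounded_clinear_linear: "bounded_clinear T \<Longrightarrow> linear T"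
  by (simp add: bounded_clinear_def bounded_linear.linear)

lemmas bounded_clinear_add = linear_add[OF bounded_clinear_linear]
  and bounded_clinear_diff = linear_diff[OF bounded_clinear_linear]
  and bounded_clinear_zero = linear_0[OF bounded_clinear_linear]

lemma bounded_clinear_scaleC: "bounded_clinear T \<Longrightarrow> T (a *\<^sub>C x) = a *\<^sub>C T x"
  by (simp add: bounded_clinear_def)

lemma bounded_clinear_bound: "bounded_clinear T \<Longrightarrow> \<exists>K>0. \<forall>x. norm (T x) \<le> norm x * K"
  by (simp add: bounded_clinear_def bounded_linear.pos_bounded)

lemma bounded_clinear_comp:
  "bounded_clinear S \<Longrightarrow> bounded_clinear T \<Longrightarrow> bounded_clinear (S \<circ> T)"
  using bounded_linear_compose[of S T] by (auto simp: bounded_clinear_def o_def)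

lemma cadjoint_exists:
  assumes T: "bounded_clinear T"
  shows "\<exists>S. \<forall>x y. cinner (T x) y = cinner x (S y)"
proof -
  have "\<exists>z. \<forall>x. cinner (T x) y = cinner x z" for y
  proof (rule riesz_representation)
    show "bounded_linear (\<lambda>x. cinner (T x) y)"
      using T unfolding bounded_clinear_def
      by (intro bounded_linear_compose[OF bounded_linear_cinner_left]) (rule conjunct1)
  qed (simp add: bounded_clinear_scaleC[OF T] cinner_simps)
  then show ?thesis by metis
qed

lemma cadjoint_eqI:
  assumes "\<And>x y. cinner (T x) y = cinner x (S y)"
  shows "cadjoint T = S"
  unfolding cadjoint_def
proof (rule the_equality)
  show "\<forall>x y. cinner (T x) y = cinner x (S y)" using assms by blast
  fix S' assume "\<forall>x y. cinner (T x) y = cinner x (S' y)"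
  then show "S' = S" using assms by (intro ext cinner_eqI) metis
qed

lemma cinner_cadjoint_right:
  assumes "bounded_clinear T"
  shows "cinner x (cadjoint T y) = cinner (T x) y"
proof -
  obtain S where S: "\<And>x y. cinner (T x) y = cinner x (S y)" using cadjoint_exists[OF assms] by blast
  have "cadjoint T = S" by (rule cadjoint_eqI) (rule S)
  then show ?thesis by (simp add: S)
qed

lemma cinner_cadjoint_left:
  "bounded_clinear T \<Longrightarrow> cinner (cadjoint T y) x = cinner y (T x)"
  by (subst (1 2) cinner_commute) (simp add: cinner_cadjoint_right)

text \<open>Boundedness follows from \<open>\<parallel>T*y\<parallel>\<^sup>2 = \<langle>T T* y, y\<rangle> \<le> K \<parallel>T*y\<parallel> \<parallel>y\<parallel>\<close>.\<close>

lemma bounded_clinear_cadjoint: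
  assumes T: "bounded_clinear T"
  shows "bounded_clinear (cadjoint T)"
proof -
  obtain K where K: "K > 0" "\<And>x. norm (T x) \<le> norm x * K" using bounded_clinear_bound[OF T] by blast
  show ?thesis
  proof (rule bounded_clinearI)
    fix y
    let ?x = "cadjoint T y"
    have "(norm ?x)\<^sup>2 = cmod (cinner (T ?x) y)"
      by (simp add: cinner_cadjoint_right[OF T, symmetric] cinner_self norm_power)
    also have "\<dots> \<le> norm (T ?x) * norm y" by (rule cmod_cinner_le)
    also have "\<dots> \<le> norm ?x * K * norm y" by (intro mult_right_mono K) simp
    finally have "norm ?x * norm ?x \<le> norm ?x * (norm y * K)"
      by (simp add: power2_eq_square mult_ac)
    then show "norm ?x \<le> norm y * K"
      using K(1) by (cases "?x = 0") (simp_all add: mult_le_cancel_left)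
  qed (rule cinner_eqI, simp add: cinner_cadjoint_right[OF T] cinner_simps)+
qed

lemma cadjoint_cadjoint: "bounded_clinear T \<Longrightarrow> cadjoint (cadjoint T) = T"
  by (intro cadjoint_eqI) (simp add: cinner_cadjoint_left)

lemma cadjoint_comp:
  "bounded_clinear S \<Longrightarrow> bounded_clinear T \<Longrightarrow> cadjoint (S \<circ> T) = cadjoint T \<circ> cadjoint S"
  by (intro cadjoint_eqI) (simp add: cinner_cadjoint_right)

lemma kernel_cadjoint: 
  assumes T: "bounded_clinear T"
  shows "kernel (cadjoint T) = orth_compl (range T)"
proof (intro set_eqI iffI)
  fix y assume "y \<in> kernel (cadjoint T)"
  then show "y \<in> orth_compl (range T)"
    by (auto simp: kernel_def orth_compl_def cinner_zero_left simp flip: cinner_cadjoint_left[OF T])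
next
  fix y assume "y \<in> orth_compl (range T)"
  then have "cinner (cadjoint T y) (cadjoint T y) = 0"
    by (simp add: orth_compl_def cinner_cadjoint_left[OF T])
  then show "y \<in> kernel (cadjoint T)" by (simp add: kernel_def cinner_self_eq_0)
qed

lemma closed_csubspace_range:
  assumes T: "bounded_clinear T" and "closed (range T)"
  shows "closed_csubspace (range T)"
proof -
  have "subspace (range T)"
    using T by (auto simp: bounded_clinear_def bounded_linear.linear intro: linear_subspace_image)
  moreover have "\<forall>a. \<forall>x\<in>range T. a *\<^sub>C x \<in> range T"
    using bounded_clinear_scaleC[OF T] by (metis imageE rangeI)
  ultimately show ?thesis using assms by (simp add: closed_csubspace_def)
qed

lemma closed_csubspace_kernel:
  assumes T: "bounded_clinear T"
  shows "closed_csubspace (kernel T)"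
  using closed_csubspace_orth_compl[of "range (cadjoint T)"]
    kernel_cadjoint[OF bounded_clinear_cadjoint[OF T]] by (simp add: cadjoint_cadjoint[OF T])

lemma range_selfadjoint_projection:
  assumes P: "bounded_clinear P" and idem: "P \<circ> P = P" and sa: "cadjoint P = P"
  shows "range P = orth_compl (kernel P)"
proof
  have ad: "cinner (P x) y = cinner x (P y)" for x y
    using cinner_cadjoint_right[OF P, of x y] by (simp add: sa)
  have PP: "P (P x) = P x" for x using idem by (metis comp_apply)
  show "range P \<subseteq> orth_compl (kernel P)"
    by (auto simp: orth_compl_def kernel_def ad cinner_simps)
  show "orth_compl (kernel P) \<subseteq> range P"
  proof
    fix y assume y: "y \<in> orth_compl (kernel P)"
    have k: "y - P y \<in> kernel P" by (simp add: kernel_def bounded_clinear_diff[OF P] PP)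
    have "cinner (y - P y) (y - P y) = 0"
      using orth_complD[OF y k] k by (simp add: cinner_diff_left ad kernel_def cinner_zero_right)
    then show "y \<in> range P" by (metis cinner_self_eq_0 eq_iff_diff_eq_0 rangeI)
  qed
qed

text \<open>Both \<open>\<langle>P x, y\<rangle>\<close> and \<open>\<langle>x, P y\<rangle>\<close> equal \<open>\<langle>P x, P y\<rangle>\<close>.\<close>

lemma selfadjoint_projectionI:
  assumes "\<And>y. P y \<in> M" "\<And>y. y - P y \<in> orth_compl M"
  shows "cadjoint P = P"
proof (rule cadjoint_eqI)
  fix x y
  have "cinner (P x) (y - P y) = 0" "cinner (x - P x) (P y) = 0"
    using assms orth_complD orth_compl_commute by blast+
  then show "cinner (P x) y = cinner x (P y)" by (simp add: cinner_simps)
qed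

section \<open>The Moore-Penrose pseudo-inverse\<close>

text \<open>The four Penrose equations. Compared with the description by kernel and range, they are purely
  algebraic and manifestly stable under taking adjoints.\<close>

definition penrose_inverse ::
    "('a::complex_hilbert_space \<Rightarrow> 'b::complex_hilbert_space) \<Rightarrow> ('b \<Rightarrow> 'a) \<Rightarrow> bool" where
  "penrose_inverse T X \<longleftrightarrow> bounded_clinear X \<and> T \<circ> X \<circ> T = T \<and> X \<circ> T \<circ> X = X \<and>
     cadjoint (T \<circ> X) = T \<circ> X \<and> cadjoint (X \<circ> T) = X \<circ> T"

lemma penrose_inverse_cadjoint:
  assumes T: "bounded_clinear T" and X: "penrose_inverse T X"
  shows "penrose_inverse (cadjoint T) (cadjoint X)"
proof -
  have bX: "bounded_clinear X" using X by (simp add: penrose_inverse_def)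
  note c = T bX bounded_clinear_comp cadjoint_comp
  have 1: "cadjoint X \<circ> cadjoint T = T \<circ> X" "cadjoint T \<circ> cadjoint X = X \<circ> T"
    using X by (simp_all add: c penrose_inverse_def flip: cadjoint_comp)
  have "cadjoint T \<circ> cadjoint X \<circ> cadjoint T = cadjoint (T \<circ> X \<circ> T)"
    "cadjoint X \<circ> cadjoint T \<circ> cadjoint X = cadjoint (X \<circ> T \<circ> X)"
    by (simp_all add: c o_assoc)
  with X 1 show ?thesis
    by (simp add: penrose_inverse_def bounded_clinear_cadjoint)
qed

lemma penrose_inverse_apply:
  assumes "penrose_inverse T X"
  shows "T (X (T x)) = T x" "X (T (X y)) = X y"
  using assms by (auto simp: penrose_inverse_def dest: fun_cong[where x = x] fun_cong[where x = y])

lemma penrose_inverse_comp_range_kernel: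
  assumes T: "bounded_clinear T" and X: "penrose_inverse T X"
  shows "range (T \<circ> X) = range T" "range (X \<circ> T) = range X"
    "kernel (X \<circ> T) = kernel T" "kernel (T \<circ> X) = kernel X"
proof -
  note TXT = penrose_inverse_apply(1)[OF X] and XTX = penrose_inverse_apply(2)[OF X]
  have z: "T 0 = 0" "X 0 = 0" using T X by (auto simp: penrose_inverse_def bounded_clinear_zero)
  have "T x \<in> range (T \<circ> X)" for x using rangeI[of "T \<circ> X" "T x"] by (simp add: TXT)
  then show "range (T \<circ> X) = range T" by auto
  have "X y \<in> range (X \<circ> T)" for y using rangeI[of "X \<circ> T" "X y"] by (simp add: XTX)
  then show "range (X \<circ> T) = range X" by auto
  have "T x = 0" if "X (T x) = 0" for x using TXT[of x] that z by simp
  moreover have "X y = 0" if "T (X y) = 0" for y using XTX[of y] that z by simp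
  ultimately show "kernel (X \<circ> T) = kernel T" "kernel (T \<circ> X) = kernel X"
    by (auto simp: kernel_def z)
qed

text \<open>By the Penrose equations \<open>T X\<close> and \<open>X T\<close> are self-adjoint idempotents, and they share their ranges
  and kernels with \<open>T\<close> and \<open>X\<close>.\<close>

lemma penrose_inverse_kernel_range:
  assumes T: "bounded_clinear T" and X: "penrose_inverse T X"
  shows "kernel X = orth_compl (range T)" "range X = orth_compl (kernel T)"
    "range T = orth_compl (kernel X)"
proof -
  have bX: "bounded_clinear X" using X by (simp add: penrose_inverse_def)
  have XTX: "X \<circ> T \<circ> X = X" "T \<circ> X \<circ> T = T" using X by (simp_all add: penrose_inverse_def)
  note r = penrose_inverse_comp_range_kernel[OF T X]
  note b = bounded_clinear_comp[OF T bX] bounded_clinear_comp[OF bX T]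
  have i: "T \<circ> X \<circ> (T \<circ> X) = T \<circ> X" "X \<circ> T \<circ> (X \<circ> T) = X \<circ> T"
    using XTX by (simp_all add: o_assoc)
  show "kernel X = orth_compl (range T)"
    using kernel_cadjoint[OF b(1)] r X by (simp add: penrose_inverse_def)
  show "range X = orth_compl (kernel T)"
    using range_selfadjoint_projection[OF b(2) i(2)] r X by (simp add: penrose_inverse_def)
  show "range T = orth_compl (kernel X)"
    using range_selfadjoint_projection[OF b(1) i(1)] r X by (simp add: penrose_inverse_def)
qed

text \<open>\<open>T X\<close> and \<open>T Y\<close> are both the orthogonal projection onto the range of \<open>T\<close>, and \<open>T\<close> is injective on
  the common range of \<open>X\<close> and \<open>Y\<close>.\<close>

lemma penrose_inverse_unique:
  assumes T: "bounded_clinear T" and X: "penrose_inverse T X" and Y: "penrose_inverse T Y"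
  shows "X = Y"
proof
  fix y
  have b: "bounded_clinear X" "bounded_clinear Y" using X Y by (simp_all add: penrose_inverse_def)
  note XTX = penrose_inverse_apply(2)[OF X] penrose_inverse_apply(2)[OF Y]
  note rX = penrose_inverse_kernel_range[OF T X] and rY = penrose_inverse_kernel_range[OF T Y]
  have "y - T (X y) \<in> orth_compl (range T)"
    unfolding rX(1)[symmetric] by (simp add: kernel_def b bounded_clinear_diff XTX)
  moreover have "y - T (Y y) \<in> orth_compl (range T)"
    unfolding rY(1)[symmetric] by (simp add: kernel_def b bounded_clinear_diff XTX)
  ultimately have "(y - T (Y y)) - (y - T (X y)) \<in> orth_compl (range T)"
    using closed_csubspace_diff[OF closed_csubspace_orth_compl] by blast
  then have "T (X y - Y y) \<in> orth_compl (range T)" by (simp add: bounded_clinear_diff[OF T])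
  then have "T (X y - Y y) = 0" by (intro orth_compl_Int[of _ "range T"]) auto
  moreover have "X y - Y y \<in> orth_compl (kernel T)"
    using closed_csubspace_diff[OF closed_csubspace_orth_compl] rX(2) rY(2) by blast
  ultimately have "X y - Y y = 0" by (intro orth_compl_Int[of _ "kernel T"]) (simp_all add: kernel_def)
  then show "X y = Y y" by simp
qed

text \<open>The description by kernel, range and \<open>T X T = T\<close> implies the Penrose equations: \<open>T X\<close> and \<open>X T\<close> turn
  out to be the orthogonal projections onto the range of \<open>T\<close> and onto the orthogonal complement of its
  kernel.\<close>

lemma penrose_inverseI:
  assumes T: "bounded_clinear T" and cl: "closed (range T)" and X: "bounded_clinear X"
    and ker: "kernel X = orth_compl (range T)" and ran: "range X = orth_compl (kernel T)"
    and TXT: "T \<circ> X \<circ> T = T"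
  shows "penrose_inverse T X"
proof -
  have t: "T (X (T x)) = T x" for x using TXT by (metis comp_apply)
  have XTX: "X (T (X y)) = X y" for y
  proof -
    obtain p where p: "p \<in> range T" "y - p \<in> orth_compl (range T)"
      using orthogonal_decomposition[OF closed_csubspace_range[OF T cl]] by blast
    then obtain u where u: "p = T u" by blast
    have "X y = X (T u)"
      using p(2) unfolding ker[symmetric] by (simp add: kernel_def bounded_clinear_diff[OF X] u)
    then show ?thesis by (simp add: t)
  qed
  have "cadjoint (T \<circ> X) = T \<circ> X"
  proof (rule selfadjoint_projectionI[where M = "range T"])
    show "y - (T \<circ> X) y \<in> orth_compl (range T)" for y
      unfolding ker[symmetric] by (simp add: kernel_def bounded_clinear_diff[OF X] XTX)
  qed simp
  moreover have "cadjoint (X \<circ> T) = X \<circ> T"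
  proof (rule selfadjoint_projectionI[where M = "orth_compl (kernel T)"])
    show "(X \<circ> T) y \<in> orth_compl (kernel T)" for y unfolding ran[symmetric] by simp
    have "y - (X \<circ> T) y \<in> kernel T" for y by (simp add: kernel_def bounded_clinear_diff[OF T] t)
    then show "y - (X \<circ> T) y \<in> orth_compl (orth_compl (kernel T))" for y
      using orth_compl_orth_compl[OF closed_csubspace_kernel[OF T]] by simp
  qed
  ultimately show ?thesis using X TXT XTX by (auto simp: penrose_inverse_def)
qed

text \<open>Send \<open>y\<close> to the preimage, orthogonal to the kernel of \<open>T\<close>, of its projection onto the range of \<open>T\<close>.
  The open mapping theorem bounds this map; linearity follows since the two orthogonality conditions
  determine the value.\<close>

lemma penrose_inverse_exists:
  assumes T: "bounded_clinear T" and cl: "closed (range T)"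
  shows "\<exists>X. penrose_inverse T X"
proof -
  note N = closed_csubspace_kernel[OF T] and R = closed_csubspace_range[OF T cl]
  note O = closed_csubspace_orth_compl
  obtain C where C: "C > 0" "\<And>y. y \<in> range T \<Longrightarrow> \<exists>x. T x = y \<and> norm x \<le> C * norm y"
    using closed_range_imp_bounded_preimages[OF _ cl] T unfolding bounded_clinear_def by blast
  have "\<exists>u. u \<in> orth_compl (kernel T) \<and> y - T u \<in> orth_compl (range T) \<and> norm u \<le> norm y * C" for y
  proof -
    obtain p where p: "p \<in> range T" "y - p \<in> orth_compl (range T)"
      using orthogonal_decomposition[OF R] by blast
    obtain x where x: "T x = p" "norm x \<le> C * norm p" using C(2)[OF p(1)] by blast
    obtain k where k: "k \<in> kernel T" "x - k \<in> orth_compl (kernel T)"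
      using orthogonal_decomposition[OF N] by blast
    have Tu: "T (x - k) = p" using x k by (simp add: bounded_clinear_diff[OF T] kernel_def)
    have "norm (x - k) \<le> norm x" "norm p \<le> norm y"
      using norm_orthogonal_le p k orth_compl_commute by blast+
    moreover have "C * norm p \<le> C * norm y" using calculation(2) C(1) by simp
    ultimately have "norm (x - k) \<le> norm y * C" using x(2) by (simp add: mult.commute)
    then show ?thesis using k(2) Tu p(2) by auto
  qed
  then obtain X where X: "\<And>y. X y \<in> orth_compl (kernel T)"
    "\<And>y. y - T (X y) \<in> orth_compl (range T)" "\<And>y. norm (X y) \<le> norm y * C" by metis
  have uniq: "X y = u" if u: "u \<in> orth_compl (kernel T)" "y - T u \<in> orth_compl (range T)" for y u
  proof -
    have "(y - T u) - (y - T (X y)) \<in> orth_compl (range T)"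
      using closed_csubspace_diff[OF O] u X by blast
    then have "T (X y - u) \<in> orth_compl (range T)" by (simp add: bounded_clinear_diff[OF T])
    then have "T (X y - u) = 0" by (intro orth_compl_Int[of _ "range T"]) auto
    then have "X y - u \<in> kernel T" by (simp add: kernel_def)
    moreover have "X y - u \<in> orth_compl (kernel T)" using closed_csubspace_diff[OF O] u X by blast
    ultimately show ?thesis using orth_compl_Int by fastforce
  qed
  have add: "x + y \<in> orth_compl S" if "x \<in> orth_compl S" "y \<in> orth_compl S" for x y :: "'x::complex_hilbert_space" and S
    using that O[of S] by (simp add: closed_csubspace_def subspace_add)
  have scl: "a *\<^sub>C x \<in> orth_compl S" if "x \<in> orth_compl S" for a and x :: "'x::complex_hilbert_space" and S
    using that O[of S] by (simp add: closed_csubspace_def)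
  have zero: "0 \<in> orth_compl S" for S :: "'x::complex_hilbert_space set"
    by (simp add: orth_compl_def cinner_simps)
  have bX: "bounded_clinear X"
  proof (rule bounded_clinearI[OF _ _ X(3)])
    fix x y :: 'b and a
    show "X (x + y) = X x + X y"
      using add[OF X(2)[of x] X(2)[of y]]
      by (intro uniq add X) (simp add: bounded_clinear_add[OF T] algebra_simps)
    show "X (a *\<^sub>C x) = a *\<^sub>C X x"
    proof (intro uniq scl X)
      have "a *\<^sub>C x - T (a *\<^sub>C X x) = a *\<^sub>C (x - T (X x))"
        using scaleC_add_right[of a "x - T (X x)" "T (X x)"] by (simp add: bounded_clinear_scaleC[OF T])
      then show "a *\<^sub>C x - T (a *\<^sub>C X x) \<in> orth_compl (range T)" using scl[OF X(2)] by simp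
    qed
  qed
  \<comment> \<open>\<open>X\<close> inverts \<open>T\<close> on the orthogonal complement of the kernel, which is therefore in its range.\<close>
  have XT: "X (T u) = u" if "u \<in> orth_compl (kernel T)" for u
    by (rule uniq[OF that]) (simp add: zero)
  have "penrose_inverse T X"
  proof (rule penrose_inverseI[OF T cl bX])
    show "kernel X = orth_compl (range T)"
    proof (intro set_eqI iffI)
      fix y assume "y \<in> kernel X"
      then show "y \<in> orth_compl (range T)"
        using X(2)[of y] by (simp add: kernel_def bounded_clinear_zero[OF T])
    next
      fix y assume "y \<in> orth_compl (range T)"
      then show "y \<in> kernel X" 
        using uniq[OF zero, of y] by (simp add: kernel_def bounded_clinear_zero[OF T])
    qed
    show "range X = orth_compl (kernel T)"
    proof (intro equalityI subsetI)
      fix u assume "u \<in> orth_compl (kernel T)"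
      then show "u \<in> range X" using rangeI[of X "T u"] by (simp add: XT)
    qed (use X(1) in auto)
    show "T \<circ> X \<circ> T = T"
    proof
      fix x
      have "T (x - X (T x)) \<in> orth_compl (range T)" using X(2)[of "T x"] by (simp add: bounded_clinear_diff[OF T])
      then have "T (x - X (T x)) = 0" by (intro orth_compl_Int[of _ "range T"]) auto
      then show "(T \<circ> X \<circ> T) x = T x" by (simp add: bounded_clinear_diff[OF T])
    qed
  qed
  then show ?thesis by blast
qed

lemma pinv_eqI:
  assumes T: "bounded_clinear T" and X: "penrose_inverse T X"
  shows "pinv T = X"
  unfolding pinv_def
proof (rule the_equality)
  show "bounded_clinear X \<and> kernel X = orth_compl (range T) \<and> range X = orth_compl (kernel T) \<and>
      T \<circ> X \<circ> T = T"
    using X penrose_inverse_kernel_range[OF T X] by (simp add: penrose_inverse_def)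
  have cl: "closed (range T)"
    using closed_csubspace_orth_compl penrose_inverse_kernel_range(3)[OF T X] by (metis closed_csubspace_def)
  fix Y assume "bounded_clinear Y \<and> kernel Y = orth_compl (range T) \<and>
      range Y = orth_compl (kernel T) \<and> T \<circ> Y \<circ> T = T"
  then show "Y = X"
    using penrose_inverse_unique[OF T _ X] penrose_inverseI[OF T cl] by blast
qed

lemma penrose_inverse_pinv:
  "bounded_clinear T \<Longrightarrow> closed (range T) \<Longrightarrow> penrose_inverse T (pinv T)"
  using penrose_inverse_exists pinv_eqI by metis

lemma pinv_eq_iff:
  assumes "bounded_clinear T" "closed (range T)"
  shows "pinv T = X \<longleftrightarrow> bounded_clinear X \<and> kernel X = orth_compl (range T) \<and>
      range X = orth_compl (kernel T) \<and> T \<circ> X \<circ> T = T"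
proof
  assume "pinv T = X"
  then have "penrose_inverse T X" using penrose_inverse_pinv[OF assms] by simp
  then show "bounded_clinear X \<and> kernel X = orth_compl (range T) \<and>
      range X = orth_compl (kernel T) \<and> T \<circ> X \<circ> T = T"
    using penrose_inverse_kernel_range[OF assms(1), of X] by (simp add: penrose_inverse_def)
next
  assume "bounded_clinear X \<and> kernel X = orth_compl (range T) \<and>
      range X = orth_compl (kernel T) \<and> T \<circ> X \<circ> T = T"
  then show "pinv T = X" by (intro pinv_eqI penrose_inverseI assms) auto
qed

lemma pinv_cadjoint:
  "bounded_clinear T \<Longrightarrow> closed (range T) \<Longrightarrow> pinv (cadjoint T) = cadjoint (pinv T)"
  by (intro pinv_eqI bounded_clinear_cadjoint penrose_inverse_cadjoint penrose_inverse_pinv)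

text \<open>The adjoint of the Penrose inverse is a Penrose inverse of the adjoint, so the range of \<open>T*\<close> is that
  of the projection \<open>T* X* = (X T)* = X T\<close>.\<close>

lemma range_cadjoint:
  assumes T: "bounded_clinear T" "closed (range T)"
  shows "range (cadjoint T) = orth_compl (kernel T)" "range (pinv T) = range (cadjoint T)"
proof -
  note b = bounded_clinear_cadjoint[OF T(1)] and p = penrose_inverse_pinv[OF T]
  have X: "bounded_clinear (pinv T)" using p by (simp add: penrose_inverse_def)
  have "range (cadjoint T) = range (cadjoint T \<circ> cadjoint (pinv T))"
    using penrose_inverse_comp_range_kernel(1)[OF b penrose_inverse_cadjoint[OF T(1) p]] by simp
  also have "\<dots> = range (pinv T \<circ> T)"
    using p by (simp add: penrose_inverse_def flip: cadjoint_comp[OF X T(1)])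
  also have "\<dots> = range (pinv T)" by (rule penrose_inverse_comp_range_kernel(2)[OF T(1) p])
  finally show "range (pinv T) = range (cadjoint T)" ..
  then show "range (cadjoint T) = orth_compl (kernel T)"
    using penrose_inverse_kernel_range(2)[OF T(1) p] by simp
qed

lemma closed_range_cadjoint:
  "bounded_clinear T \<Longrightarrow> closed (range T) \<Longrightarrow> closed (range (cadjoint T))"
  using closed_csubspace_orth_compl[of "kernel T"] by (simp add: range_cadjoint(1) closed_csubspace_def)

lemma pinv_range_projection:
  assumes U: "bounded_clinear U" "closed (range U)"
  shows "bounded_clinear (U \<circ> pinv U)" "cadjoint (U \<circ> pinv U) = U \<circ> pinv U"
    "range (U \<circ> pinv U) = range U" "\<And>x. x \<in> range U \<Longrightarrow> (U \<circ> pinv U) x = x"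
    "kernel (U \<circ> pinv U) = kernel (cadjoint U)"
proof -
  note p = penrose_inverse_pinv[OF U]
  show "bounded_clinear (U \<circ> pinv U)" "cadjoint (U \<circ> pinv U) = U \<circ> pinv U"
    using p by (simp_all add: penrose_inverse_def bounded_clinear_comp U)
  show "range (U \<circ> pinv U) = range U" by (rule penrose_inverse_comp_range_kernel(1)[OF U(1) p])
  show "(U \<circ> pinv U) x = x" if "x \<in> range U" for x
    using that penrose_inverse_apply(1)[OF p] by auto
  show "kernel (U \<circ> pinv U) = kernel (cadjoint U)"
    using penrose_inverse_comp_range_kernel(4)[OF U(1) p] penrose_inverse_kernel_range(1)[OF U(1) p]
    by (simp add: kernel_cadjoint[OF U(1)])
qed

section \<open>Bessel sequences\<close>

lemma cinner_unit_ell2: "cinner (unit_ell2 i) d = cnj (coord d i)"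
proof -
  have "cinner (unit_ell2 i) d = (\<Sum>\<^sub>\<infinity>k\<in>{i}. coord (unit_ell2 i) k * cnj (coord d k))"
    unfolding cinner_ell2_def by (rule infsum_cong_neutral) (auto simp: coord_unit_ell2)
  then show ?thesis by (simp add: coord_unit_ell2)
qed

text \<open>The squared norm of the remainder of a finite partial sum is the remainder of the convergent series
  of the \<open>|c\<^sub>i|\<^sup>2\<close>.\<close>

lemma has_sum_unit_ell2: "((\<lambda>i. coord c i *\<^sub>C unit_ell2 i) has_sum c) UNIV"
proof -
  define s where "s F = (\<Sum>i\<in>F. coord c i *\<^sub>C unit_ell2 i)" for F
  have s: "coord (s F) j = (if j \<in> F then coord c j else 0)" if "finite F" for F j
    unfolding s_def using that
    by (induction F rule: finite_induct) (auto simp: coord_simps coord_scaleC coord_unit_ell2)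
  have eq: "(norm (s F - c))\<^sup>2 = (norm c)\<^sup>2 - (\<Sum>i\<in>F. (cmod (coord c i))\<^sup>2)" if F: "finite F" for F
  proof -
    have "(norm (s F - c))\<^sup>2 = (\<Sum>\<^sub>\<infinity>j\<in>UNIV - F. (cmod (coord c j))\<^sup>2)"
      unfolding norm_sq_ell2 by (rule infsum_cong_neutral) (auto simp: coord_minus s[OF F])
    also have "\<dots> = (\<Sum>\<^sub>\<infinity>j. (cmod (coord c j))\<^sup>2) - (\<Sum>\<^sub>\<infinity>j\<in>F. (cmod (coord c j))\<^sup>2)"
      using F by (intro infsum_Diff coord_summable) auto
    finally show ?thesis using F by (simp add: norm_sq_ell2)
  qed
  have "((\<lambda>F. \<Sum>i\<in>F. (cmod (coord c i))\<^sup>2) \<longlongrightarrow> (norm c)\<^sup>2) (finite_subsets_at_top UNIV)"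
    using has_sum_infsum[OF coord_summable[of c]] by (simp add: has_sum_def norm_sq_ell2)
  from tendsto_diff[OF tendsto_const this, of "(norm c)\<^sup>2"]
  have "((\<lambda>F. (norm c)\<^sup>2 - (\<Sum>i\<in>F. (cmod (coord c i))\<^sup>2)) \<longlongrightarrow> 0) (finite_subsets_at_top UNIV)"
    by simp
  then have "((\<lambda>F. (norm (s F - c))\<^sup>2) \<longlongrightarrow> 0) (finite_subsets_at_top UNIV)"
    by (rule Lim_transform_eventually) (auto simp: eq intro!: eventually_finite_subsets_at_top_weakI)
  from tendsto_real_sqrt[OF this] have "((\<lambda>F. norm (s F - c)) \<longlongrightarrow> 0) (finite_subsets_at_top UNIV)"
    by simp
  then have "(s \<longlongrightarrow> c) (finite_subsets_at_top UNIV)"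
    by (simp add: tendsto_norm_zero_iff LIM_zero_iff)
  then show ?thesis by (simp add: has_sum_def s_def[abs_def])
qed

lemma coord_analysis: "bessel_on UNIV \<phi> \<Longrightarrow> coord (analysis \<phi> f) i = cinner f (\<phi> i)"
  by (auto simp: analysis_def bessel_on_def coord_Abs)

lemma bounded_clinear_analysis:
  assumes \<phi>: "bessel_on UNIV \<phi>"
  shows "bounded_clinear (analysis \<phi>)"
proof -
  note c = coord_analysis[OF \<phi>]
  obtain B where B: "B > 0" "\<And>f. (\<Sum>\<^sub>\<infinity>i. (cmod (cinner f (\<phi> i)))\<^sup>2) \<le> B * (norm f)\<^sup>2"
    using \<phi> by (auto simp: bessel_on_def)
  show ?thesis
  proof (rule bounded_clinearI)
    fix f
    have "(norm (analysis \<phi> f))\<^sup>2 \<le> (norm f * sqrt B)\<^sup>2"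
      using B by (simp add: norm_sq_ell2 c power_mult_distrib mult.commute)
    then show "norm (analysis \<phi> f) \<le> norm f * sqrt B"
      by (rule power2_le_imp_le) (use B in simp)
  qed (rule ell2_eqI, simp add: c coord_simps coord_scaleC cinner_simps)+
qed

text \<open>A bounded operator carries the unit vector expansion of \<open>c\<close> over to its image, and the adjoint of
  the analysis operator maps the \<open>i\<close>-th unit vector to \<open>\<phi> i\<close>. In particular the synthesis series
  converges unconditionally.\<close>

lemma has_sum_cadjoint_analysis:
  assumes \<phi>: "bessel_on UNIV \<phi>"
  shows "((\<lambda>i. coord c i *\<^sub>C \<phi> i) has_sum cadjoint (analysis \<phi>) c) UNIV"
proof -
  note A = bounded_clinear_analysis[OF \<phi>]
  let ?T = "cadjoint (analysis \<phi>)"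
  have T: "bounded_clinear ?T" by (rule bounded_clinear_cadjoint[OF A])
  have "?T (unit_ell2 i) = \<phi> i" for i
  proof (rule cinner_eqI)
    fix x
    have "cinner x (?T (unit_ell2 i)) = cnj (cinner (unit_ell2 i) (analysis \<phi> x))"
      by (simp add: cinner_cadjoint_right[OF A] flip: cinner_commute)
    then show "cinner x (?T (unit_ell2 i)) = cinner x (\<phi> i)"
      by (simp add: cinner_unit_ell2 coord_analysis[OF \<phi>])
  qed
  moreover have "((\<lambda>i. ?T (coord c i *\<^sub>C unit_ell2 i)) has_sum ?T c) UNIV"
    by (rule has_sum_bounded_linear[OF _ has_sum_unit_ell2]) (use T in \<open>simp add: bounded_clinear_def\<close>)
  ultimately show ?thesis by (simp add: bounded_clinear_scaleC[OF T])
qed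

lemma synthesis_eq_cadjoint_analysis:
  assumes "bessel_on UNIV \<phi>"
  shows "synthesis \<phi> = cadjoint (analysis \<phi>)"
  using infsumI[OF has_sum_cadjoint_analysis[OF assms]] by (auto simp: synthesis_def)

lemma has_sum_synthesis:
  "bessel_on UNIV \<phi> \<Longrightarrow> ((\<lambda>i. coord c i *\<^sub>C \<phi> i) has_sum synthesis \<phi> c) UNIV"
  by (simp add: synthesis_eq_cadjoint_analysis has_sum_cadjoint_analysis)

lemma bounded_clinear_synthesis: "bessel_on UNIV \<phi> \<Longrightarrow> bounded_clinear (synthesis \<phi>)"
  by (simp add: synthesis_eq_cadjoint_analysis bounded_clinear_cadjoint bounded_clinear_analysis)

lemma cadjoint_synthesis: "bessel_on UNIV \<phi> \<Longrightarrow> cadjoint (synthesis \<phi>) = analysis \<phi>"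
  by (simp add: synthesis_eq_cadjoint_analysis cadjoint_cadjoint bounded_clinear_analysis)

text \<open>The coefficients of \<open>f\<close> are those of its projection onto \<open>K\<close>, which is no longer than \<open>f\<close>. So the
  analysis and synthesis operators of a Bessel sequence in a subspace can be studied in the whole
  space.\<close>

lemma bessel_on_imp_UNIV:
  assumes K: "closed_csubspace K" and \<phi>: "bessel_on K \<phi>"
  shows "bessel_on UNIV \<phi>"
proof -
  obtain B where B: "B > 0" "\<And>f. f \<in> K \<Longrightarrow> (\<lambda>i. (cmod (cinner f (\<phi> i)))\<^sup>2) summable_on UNIV"
    "\<And>f. f \<in> K \<Longrightarrow> (\<Sum>\<^sub>\<infinity>i. (cmod (cinner f (\<phi> i)))\<^sup>2) \<le> B * (norm f)\<^sup>2"
    and ran: "\<And>i. \<phi> i \<in> K" using \<phi> by (auto simp: bessel_on_def)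
  have "(\<lambda>i. (cmod (cinner f (\<phi> i)))\<^sup>2) summable_on UNIV \<and>
      (\<Sum>\<^sub>\<infinity>i. (cmod (cinner f (\<phi> i)))\<^sup>2) \<le> B * (norm f)\<^sup>2" for f
  proof -
    obtain p where p: "p \<in> K" "f - p \<in> orth_compl K" using orthogonal_decomposition[OF K] by blast
    have "cinner f (\<phi> i) = cinner p (\<phi> i)" for i
      using orth_complD[OF p(2) ran[of i]] by (simp add: cinner_diff_left)
    moreover have "norm p \<le> norm f"
      by (rule norm_orthogonal_le(1)) (rule orth_compl_commute[OF p(2) p(1)])
    then have "B * (norm p)\<^sup>2 \<le> B * (norm f)\<^sup>2" using B(1) by (simp add: power_mono)
    ultimately show ?thesis using B(2,3)[OF p(1)] by simp
  qed
  then show ?thesis using B(1) by (auto simp: bessel_on_def)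
qed

text \<open>The analysis operator vanishes on the orthogonal complement of \<open>K\<close>, so its adjoint maps into \<open>K\<close>.\<close>

lemma synthesis_in_subspace:
  assumes K: "closed_csubspace K" and \<phi>: "bessel_on K \<phi>"
  shows "synthesis \<phi> c \<in> K"
proof -
  note b = bessel_on_imp_UNIV[OF K \<phi>]
  have "cinner (synthesis \<phi> c) k = 0" if k: "k \<in> orth_compl K" for k
  proof -
    have "coord (analysis \<phi> k) i = 0" for i
      using orth_complD[OF k, of "\<phi> i"] \<phi> by (auto simp: coord_analysis[OF b] bessel_on_def)
    then have "analysis \<phi> k = 0" by (intro ell2_eqI) (simp add: coord_zero)
    then show ?thesis
      using cinner_cadjoint_right[OF bounded_clinear_synthesis[OF b], of c k]
      by (simp add: cadjoint_synthesis[OF b] cinner_zero_right)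
  qed
  then have "synthesis \<phi> c \<in> orth_compl (orth_compl K)" by (rule orth_complI)
  then show ?thesis by (simp add: orth_compl_orth_compl[OF K])
qed

lemma bessel_on_image:
  fixes \<phi> :: "'i \<Rightarrow> 'a::complex_hilbert_space" and T :: "'a \<Rightarrow> 'b::complex_hilbert_space"
  assumes \<phi>: "bessel_on UNIV \<phi>" and T: "bounded_clinear T" and ran: "range T \<subseteq> K"
  shows "bessel_on K (\<lambda>i. T (\<phi> i))"
proof -
  obtain B where B: "B > 0" "\<And>f. (\<lambda>i. (cmod (cinner f (\<phi> i)))\<^sup>2) summable_on UNIV"
    "\<And>f. (\<Sum>\<^sub>\<infinity>i. (cmod (cinner f (\<phi> i)))\<^sup>2) \<le> B * (norm f)\<^sup>2"
    using \<phi> by (auto simp: bessel_on_def)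
  obtain C where C: "C > 0" "\<And>f. norm (cadjoint T f) \<le> norm f * C"
    using bounded_clinear_bound[OF bounded_clinear_cadjoint[OF T]] by blast
  have "(\<Sum>\<^sub>\<infinity>i. (cmod (cinner f (T (\<phi> i))))\<^sup>2) \<le> (B * C\<^sup>2) * (norm f)\<^sup>2" for f
  proof -
    have "(norm (cadjoint T f))\<^sup>2 \<le> (norm f * C)\<^sup>2" by (rule power_mono[OF C(2)]) simp
    then have "B * (norm (cadjoint T f))\<^sup>2 \<le> B * (norm f * C)\<^sup>2" using B(1) by simp
    then show ?thesis using B(3)[of "cadjoint T f"]
      by (simp add: cinner_cadjoint_left[OF T] power_mult_distrib mult_ac)
  qed
  moreover have "(\<lambda>i. (cmod (cinner f (T (\<phi> i))))\<^sup>2) summable_on UNIV" for f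
    using B(2)[of "cadjoint T f"] by (simp add: cinner_cadjoint_left[OF T])
  moreover have "B * C\<^sup>2 > 0" using B(1) C(1) by simp
  ultimately show ?thesis using ran unfolding bessel_on_def by blast
qed

lemma analysis_image:
  assumes \<phi>: "bessel_on UNIV \<phi>" and T: "bounded_clinear T"
  shows "analysis (\<lambda>i. T (\<phi> i)) = analysis \<phi> \<circ> cadjoint T"
  using coord_analysis[OF \<phi>] coord_analysis[OF bessel_on_image[OF \<phi> T subset_UNIV]]
  by (intro ext ell2_eqI) (simp add: cinner_cadjoint_left[OF T])

lemma synthesis_image:
  assumes \<phi>: "bessel_on UNIV \<phi>" and T: "bounded_clinear T"
  shows "synthesis (\<lambda>i. T (\<phi> i)) = T \<circ> synthesis \<phi>"
  by (simp add: synthesis_eq_cadjoint_analysis \<phi> bessel_on_image[OF \<phi> T subset_UNIV] analysis_image[OF \<phi> T]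
      cadjoint_comp bounded_clinear_analysis bounded_clinear_cadjoint T cadjoint_cadjoint)

section \<open>Frames and canonical duals\<close>

lemma bounded_clinear_frame_operator:
  "bessel_on UNIV \<phi> \<Longrightarrow> bounded_clinear (frame_operator \<phi>)"
  unfolding frame_operator_def
  by (intro bounded_clinear_comp bounded_clinear_synthesis bounded_clinear_analysis)

lemma cadjoint_frame_operator:
  "bessel_on UNIV \<phi> \<Longrightarrow> cadjoint (frame_operator \<phi>) = frame_operator \<phi>"
  unfolding frame_operator_def
  by (simp add: cadjoint_comp bounded_clinear_synthesis bounded_clinear_analysis
      cadjoint_synthesis synthesis_eq_cadjoint_analysis[symmetric])

lemma cinner_frame_operator:
  assumes "bessel_on UNIV \<phi>"
  shows "cinner (frame_operator \<phi> f) f = complex_of_real ((norm (analysis \<phi> f))\<^sup>2)"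
  using cinner_cadjoint_left[OF bounded_clinear_analysis[OF assms], of "analysis \<phi> f" f]
  by (simp only: frame_operator_def comp_apply synthesis_eq_cadjoint_analysis[OF assms] cinner_self)

text \<open>The Lax-Milgram argument. Coercivity bounds \<open>D\<close> below on \<open>K\<close>, so \<open>D\<close> is injective there and its image
  is closed; a vector \<open>q\<close> of \<open>K\<close> orthogonal to that image satisfies \<open>\<langle>D q, q\<rangle> = 0\<close> and hence is zero.\<close>

lemma coercive_operator:
  fixes D :: "'a::complex_hilbert_space \<Rightarrow> 'a"
  assumes K: "closed_csubspace K" and D: "bounded_clinear D" and ran: "range D \<subseteq> K"
    and "A > 0" and coer: "\<And>f. f \<in> K \<Longrightarrow> A * (norm f)\<^sup>2 \<le> Re (cinner (D f) f)"
  shows "D ` K = K" "inj_on D K"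
proof -
  have below: "A * norm f \<le> norm (D f)" if "f \<in> K" for f
  proof -
    have "A * (norm f)\<^sup>2 \<le> cmod (cinner (D f) f)" using coer[OF that] complex_Re_le_cmod order_trans by blast
    also have "\<dots> \<le> norm (D f) * norm f" by (rule cmod_cinner_le)
    finally show ?thesis by (cases "f = 0") (simp_all add: power2_eq_square)
  qed
  have Ks: "subspace K" "closed K" "\<And>a x. x \<in> K \<Longrightarrow> a *\<^sub>C x \<in> K"
    using K by (auto simp: closed_csubspace_def)
  have "complete (D ` K)"
    using D Ks below \<open>A > 0\<close>
    by (intro complete_isometric_image[where e = A])
      (auto simp: bounded_clinear_def complete_eq_closed)
  then have "closed (D ` K)" by (rule complete_imp_closed)
  moreover have "subspace (D ` K)"
    by (rule linear_subspace_image[OF bounded_clinear_linear[OF D] Ks(1)])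
  moreover have "a *\<^sub>C x \<in> D ` K" if "x \<in> D ` K" for a x
    using that Ks(3) by (auto simp flip: bounded_clinear_scaleC[OF D])
  ultimately have DK: "closed_csubspace (D ` K)" by (simp add: closed_csubspace_def)
  show "D ` K = K"
  proof
    show "K \<subseteq> D ` K"
    proof
      fix g assume g: "g \<in> K"
      obtain p where p: "p \<in> D ` K" "g - p \<in> orth_compl (D ` K)"
        using orthogonal_decomposition[OF DK] by blast
      have q: "g - p \<in> K" using g p(1) ran closed_csubspace_diff[OF K] by blast
      then have "cinner (D (g - p)) (g - p) = 0" using orth_compl_commute[OF p(2)] by blast
      then have "A * (norm (g - p))\<^sup>2 \<le> 0" using coer[OF q] by simp
      then have "g = p" using \<open>A > 0\<close> by (simp add: mult_le_0_iff)
      then show "g \<in> D ` K" using p(1) by simp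
    qed
  qed (use ran in auto)
  show "inj_on D K"
  proof (rule inj_onI)
    fix x y assume xy: "x \<in> K" "y \<in> K" "D x = D y"
    then have "A * norm (x - y) \<le> 0"
      using below[OF closed_csubspace_diff[OF K xy(1,2)]] by (simp add: bounded_clinear_diff[OF D])
    then show "x = y" using \<open>A > 0\<close> by (simp add: mult_le_0_iff)
  qed
qed

lemma frame_operator_coercive:
  assumes "frame_on UNIV \<phi>"
  shows "\<exists>A>0. \<forall>f. A * (norm f)\<^sup>2 \<le> Re (cinner (frame_operator \<phi> f) f)"
proof -
  have b: "bessel_on UNIV \<phi>" using assms by (simp add: frame_on_def)
  obtain A where "A > 0" "\<And>f. A * (norm f)\<^sup>2 \<le> (\<Sum>\<^sub>\<infinity>i. (cmod (cinner f (\<phi> i)))\<^sup>2)"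
    using assms by (auto simp: frame_on_def)
  then show ?thesis
    by (intro exI[of _ A]) (simp add: cinner_frame_operator[OF b] norm_sq_ell2 coord_analysis[OF b])
qed

text \<open>The frame operator of the projected frame \<open>P\<phi>\<close> is \<open>P S P\<close>, which is coercive on \<open>K\<close> and vanishes on
  the orthogonal complement. Its inverse on \<open>K\<close>, used in the canonical dual, is therefore the
  restriction of its pseudo-inverse \<open>R\<close>, a bounded self-adjoint operator on the whole space.\<close>

lemma canonical_dual_projected_frame:
  fixes \<phi> :: "'i \<Rightarrow> 'a::complex_hilbert_space" and P :: "'a \<Rightarrow> 'a"
  assumes \<phi>: "frame_on UNIV \<phi>" and P: "bounded_clinear P" "cadjoint P = P"
    and K: "closed_csubspace K" "range P = K" "\<And>x. x \<in> K \<Longrightarrow> P x = x"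
  shows "\<exists>R. bounded_clinear R \<and> cadjoint R = R \<and>
    canonical_dual K (\<lambda>i. P (\<phi> i)) = (\<lambda>i. R (P (\<phi> i))) \<and> range R = K \<and> inj_on R K \<and>
    (\<forall>f\<in>K. R (P (frame_operator \<phi> f)) = f \<and> P (frame_operator \<phi> (R f)) = f)"
proof -
  define D where "D = frame_operator (\<lambda>i. P (\<phi> i))"
  have b: "bessel_on UNIV \<phi>" using \<phi> by (simp add: frame_on_def)
  have bP: "bessel_on UNIV (\<lambda>i. P (\<phi> i))" by (rule bessel_on_image[OF b P(1) subset_UNIV])
  have D_eq: "D f = P (frame_operator \<phi> (P f))" for f
    by (simp add: D_def frame_operator_def analysis_image[OF b P(1)] synthesis_image[OF b P(1)] P(2))
  have D: "bounded_clinear D" "cadjoint D = D"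
    unfolding D_def by (rule bounded_clinear_frame_operator[OF bP] cadjoint_frame_operator[OF bP])+
  have DK: "D f \<in> K" for f using K(2) by (auto simp: D_eq)
  obtain A where A: "A > 0" "\<And>f. A * (norm f)\<^sup>2 \<le> Re (cinner (frame_operator \<phi> f) f)"
    using frame_operator_coercive[OF \<phi>] by blast
  have adP: "cinner (P x) y = cinner x (P y)" for x y
    using cinner_cadjoint_right[OF P(1), of x y] by (simp add: P(2))
  have coer: "A * (norm f)\<^sup>2 \<le> Re (cinner (D f) f)" if "f \<in> K" for f
    using A(2)[of f] that by (simp add: D_eq K(3) adP)
  have "range D \<subseteq> K" using DK by auto
  note c = coercive_operator[OF K(1) D(1) this A(1) coer]
  have ranD: "range D = K" using c(1) \<open>range D \<subseteq> K\<close> by blast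
  have clD: "closed (range D)" using K(1) by (simp add: ranD closed_csubspace_def)
  define R where "R = pinv D"
  have pR: "penrose_inverse D R" unfolding R_def by (rule penrose_inverse_pinv[OF D(1) clD])
  have R: "bounded_clinear R" using pR by (simp add: penrose_inverse_def)
  have "cadjoint R = R" using pinv_cadjoint[OF D(1) clD] D(2) by (simp add: R_def)
  have ranR: "range R = K"
    using range_cadjoint(2)[OF D(1) clD] by (simp add: D(2) ranD R_def)
  have RK: "R f \<in> K" for f using ranR by auto
  have DR: "D (R f) = f" if "f \<in> K" for f
    using that penrose_inverse_apply(1)[OF pR] by (auto simp flip: ranD)
  have RD: "R (D f) = f" if "f \<in> K" for f
    using c(2) DR[OF DK] RK that by (auto dest: inj_onD)
  show ?thesis
  proof (intro exI[of _ R] conjI ballI)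
    show "canonical_dual K (\<lambda>i. P (\<phi> i)) = (\<lambda>i. R (P (\<phi> i)))"
    proof
      fix i
      have "P (\<phi> i) \<in> K" using K(2) by auto
      then show "canonical_dual K (\<lambda>i. P (\<phi> i)) i = R (P (\<phi> i))"
        unfolding canonical_dual_def D_def[symmetric]
        by (intro inv_into_f_eq c RK DR)
    qed
    show "inj_on R K" by (rule inj_on_inverseI[of K D]) (rule DR)
    show "R (P (frame_operator \<phi> f)) = f" if "f \<in> K" for f
      using RD[OF that] by (simp add: D_eq K(3)[OF that])
    show "P (frame_operator \<phi> (R f)) = f" if "f \<in> K" for f
      using DR[OF that] by (simp add: D_eq K(3)[OF RK])
  qed fact+
qed

lemma dual_on_synthesis_analysis:
  assumes K: "closed_csubspace K" and \<phi>: "bessel_on UNIV \<phi>" and \<phi>': "bessel_on K \<phi>'"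
  shows "dual_on K \<phi> \<phi>' \<longleftrightarrow> (\<forall>f\<in>K. synthesis \<phi>' (analysis \<phi> f) = f)"
proof -
  have "((\<lambda>i. cinner f (\<phi> i) *\<^sub>C \<phi>' i) has_sum synthesis \<phi>' (analysis \<phi> f)) UNIV" for f
    using has_sum_synthesis[OF bessel_on_imp_UNIV[OF K \<phi>'], of "analysis \<phi> f"]
    by (simp add: coord_analysis[OF \<phi>])
  then have "((\<lambda>i. cinner f (\<phi> i) *\<^sub>C \<phi>' i) has_sum f) UNIV
      \<longleftrightarrow> synthesis \<phi>' (analysis \<phi> f) = f" for f
    using has_sum_unique by metis
  then show ?thesis using \<phi>' by (simp add: dual_on_def)
qed

lemma cadjoint_cross_gram:
  assumes "bessel_on UNIV \<phi>" "bessel_on UNIV \<psi>" and "bounded_clinear U"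
  shows "bounded_clinear (cross_gram U \<phi> \<psi>)"
    "cadjoint (cross_gram U \<phi> \<psi>) = cross_gram (cadjoint U) \<psi> \<phi>"
  using assms
  by (simp_all add: cross_gram_def bounded_clinear_comp bounded_clinear_analysis
      bounded_clinear_synthesis cadjoint_comp cadjoint_synthesis o_assoc flip: synthesis_eq_cadjoint_analysis)

lemma canonical_dual_UNIV:
  fixes \<psi> :: "'i \<Rightarrow> 'a::complex_hilbert_space"
  assumes "frame_on UNIV \<psi>"
  shows "\<exists>R. bounded_clinear R \<and> cadjoint R = R \<and> canonical_dual UNIV \<psi> = (\<lambda>i. R (\<psi> i)) \<and>
    (\<forall>f. R (frame_operator \<psi> f) = f \<and> frame_operator \<psi> (R f) = f)"
proof -
  have id: "bounded_clinear (\<lambda>x::'a. x)" "cadjoint (\<lambda>x::'a. x) = (\<lambda>x. x)"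
    by (rule bounded_clinearI[where K = 1], auto intro: cadjoint_eqI)
  show ?thesis
    using canonical_dual_projected_frame[OF assms id closed_csubspace_UNIV] by auto
qed

lemma synthesis_surj:
  assumes "frame_on UNIV \<phi>"
  shows "range (synthesis \<phi>) = UNIV"
proof -
  obtain R where "\<And>f. frame_operator \<phi> (R f) = f" using canonical_dual_UNIV[OF assms] by blast
  then have "\<And>f. f = synthesis \<phi> (analysis \<phi> (R f))" by (simp add: frame_operator_def)
  then show ?thesis by blast
qed

lemma inj_analysis:
  assumes "frame_on UNIV \<phi>"
  shows "inj (analysis \<phi>)"
proof -
  obtain R where "\<And>f. R (frame_operator \<phi> f) = f" using canonical_dual_UNIV[OF assms] by blast
  then have "\<And>f. R (synthesis \<phi> (analysis \<phi> f)) = f" by (simp add: frame_operator_def)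
  then show ?thesis by (rule inj_on_inverseI)
qed

text \<open>With \<open>P = U U\<dagger>\<close> the synthesis operator of the canonical dual of \<open>P\<phi>\<close> is \<open>R P T_\<phi>\<close>. On \<open>R(U)\<close> the
  coefficients with respect to \<open>\<phi>\<close> and \<open>P\<phi>\<close> coincide, so the canonical dual of \<open>P\<phi>\<close> is a dual of
  \<open>\<phi>\<close>. Since \<open>R\<close> is injective on \<open>R(U)\<close>, the kernel of \<open>R P T_\<phi>\<close> is that of \<open>P T_\<phi>\<close>, and \<open>P\<close>
  has the same kernel as \<open>U*\<close>.\<close>

lemma canonical_dual_on_range:
  assumes \<phi>: "frame_on UNIV \<phi>" and U: "bounded_clinear U" "closed (range U)"
  defines "\<phi>' \<equiv> canonical_dual (range U) (\<lambda>i. U (pinv U (\<phi> i)))"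
  shows "dual_on (range U) \<phi> \<phi>'" "kernel (synthesis \<phi>') = kernel (cadjoint U \<circ> synthesis \<phi>)"
proof -
  define P where "P = U \<circ> pinv U"
  note P = pinv_range_projection[OF U, folded P_def]
  note K = closed_csubspace_range[OF U]
  have b: "bessel_on UNIV \<phi>" using \<phi> by (simp add: frame_on_def)
  obtain R where R: "bounded_clinear R"
    "canonical_dual (range U) (\<lambda>i. P (\<phi> i)) = (\<lambda>i. R (P (\<phi> i)))"
    "range R = range U" "inj_on R (range U)"
    "\<And>f. f \<in> range U \<Longrightarrow> R (P (frame_operator \<phi> f)) = f"
    using canonical_dual_projected_frame[OF \<phi> P(1,2) K P(3,4)] by blast
  have eq: "\<phi>' = (\<lambda>i. (R \<circ> P) (\<phi> i))" using R(2) by (simp add: \<phi>'_def P_def)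
  note RP = bounded_clinear_comp[OF R(1) P(1)]
  have syn: "synthesis \<phi>' = (R \<circ> P) \<circ> synthesis \<phi>" unfolding eq by (rule synthesis_image[OF b RP])
  have bes: "bessel_on (range U) \<phi>'"
    unfolding eq by (rule bessel_on_image[OF b RP]) (use R(3) in auto)
  show "dual_on (range U) \<phi> \<phi>'"
    using R(5) by (simp add: dual_on_synthesis_analysis[OF K b bes] syn frame_operator_def)
  have "R (P x) = 0 \<longleftrightarrow> cadjoint U x = 0" for x
  proof -
    have "R (P x) = 0 \<longleftrightarrow> P x = 0"
    proof
      assume "R (P x) = 0"
      then have "R (P x) = R 0" by (simp add: bounded_clinear_zero[OF R(1)])
      moreover have "P x \<in> range U" "0 \<in> range U"
        using P(3) rangeI[of P x] rangeI[of U 0] by (auto simp: bounded_clinear_zero[OF U(1)])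
      ultimately show "P x = 0" using R(4) by (auto dest: inj_onD)
    qed (simp add: bounded_clinear_zero[OF R(1)])
    also have "\<dots> \<longleftrightarrow> cadjoint U x = 0" using P(5) by (auto simp: kernel_def)
    finally show ?thesis .
  qed
  then show "kernel (synthesis \<phi>') = kernel (cadjoint U \<circ> synthesis \<phi>)"
    by (simp add: kernel_def syn)
qed

section \<open>The pseudo-inverse of a cross Gram matrix\<close>

text \<open>The right-hand side separates the range condition on the candidate \<open>X\<close>, which depends on neither \<open>\<phi>\<close> nor
  \<open>\<phi>'\<close>, from the kernel condition, which does not depend on \<open>\<psi>\<close>; the remaining requirement \<open>G X G = G\<close> is automatic.\<close>

lemma pinv_cross_gram_dual_iff:
  fixes U :: "'a::complex_hilbert_space \<Rightarrow> 'b::complex_hilbert_space"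
  assumes \<psi>: "frame_on UNIV \<psi>" and \<phi>: "frame_on UNIV \<phi>"
    and U: "bounded_clinear U" "closed (range U)" and G: "closed (range (cross_gram U \<phi> \<psi>))"
    and dual: "dual_on (range U) \<phi> \<phi>'"
  shows "pinv (cross_gram U \<phi> \<psi>) = cross_gram (pinv U) (canonical_dual UNIV \<psi>) \<phi>' \<longleftrightarrow>
      range (cadjoint U) = frame_operator \<psi> ` range (cadjoint U) \<and>
      kernel (synthesis \<phi>') = kernel (cadjoint U \<circ> synthesis \<phi>)"
proof -
  define X where "X = cross_gram (pinv U) (canonical_dual UNIV \<psi>) \<phi>'"
  let ?G = "cross_gram U \<phi> \<psi>"
  let ?S = "frame_operator \<psi>"
  note K = closed_csubspace_range[OF U]
  note p = penrose_inverse_pinv[OF U]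
  have bpinv: "bounded_clinear (pinv U)" using p by (simp add: penrose_inverse_def)
  have b: "bessel_on UNIV \<psi>" "bessel_on UNIV \<phi>" and b': "bessel_on (range U) \<phi>'"
    using \<psi> \<phi> dual by (simp_all add: frame_on_def dual_on_def)
  have syndual: "synthesis \<phi>' (analysis \<phi> (U x)) = U x" for x
    using dual by (simp add: dual_on_synthesis_analysis[OF K b(2) b'])
  note b'' = bessel_on_imp_UNIV[OF K b']
  obtain R where R: "bounded_clinear R" "cadjoint R = R"
    "canonical_dual UNIV \<psi> = (\<lambda>i. R (\<psi> i))" "\<And>f. R (?S f) = f" "\<And>f. ?S (R f) = f"
    using canonical_dual_UNIV[OF \<psi>] by blast
  note bG = cadjoint_cross_gram[OF b(2,1) U(1)]
  have X: "X c = analysis \<psi> (R (pinv U (synthesis \<phi>' c)))" for c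
    by (simp add: X_def cross_gram_def R(3) analysis_image[OF b(1) R(1)] R(2))
  have bX: "bounded_clinear X"
    unfolding X_def R(3)
    by (rule cadjoint_cross_gram(1)[OF bessel_on_image[OF b(1) R(1) subset_UNIV] b'' bpinv])
  have GXG: "?G \<circ> X \<circ> ?G = ?G"
  proof
    fix c
    have "synthesis \<psi> (analysis \<psi> (R y)) = y" for y using R(5) by (simp add: frame_operator_def)
    then show "(?G \<circ> X \<circ> ?G) c = ?G c"
      by (simp add: X cross_gram_def syndual penrose_inverse_apply(1)[OF p])
  qed
  have inj: "inj (analysis \<psi>)" by (rule inj_analysis[OF \<psi>])
  have ran_syn: "range (synthesis \<phi>') = range U"
  proof (intro equalityI subsetI)
    fix y assume "y \<in> range U"
    then obtain x where "y = U x" by blast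
    then have "y = synthesis \<phi>' (analysis \<phi> (U x))" by (simp add: syndual)
    then show "y \<in> range (synthesis \<phi>')" by blast
  qed (use synthesis_in_subspace[OF K b'] in auto)
  have "range X = analysis \<psi> ` R ` pinv U ` range (synthesis \<phi>')" by (auto simp: X)
  also have "pinv U ` range (synthesis \<phi>') = range (cadjoint U)"
    using penrose_inverse_comp_range_kernel(2)[OF U(1) p] range_cadjoint(2)[OF U]
    by (simp add: ran_syn image_comp)
  finally have ranX: "range X = analysis \<psi> ` R ` range (cadjoint U)" .
  have "orth_compl (kernel ?G) = range (cadjoint ?G)" using range_cadjoint(1)[OF bG(1) G] ..
  also have "\<dots> = analysis \<psi> ` cadjoint U ` range (synthesis \<phi>)"
    unfolding bG(2) by (simp add: cross_gram_def image_comp o_def)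
  also have "\<dots> = analysis \<psi> ` range (cadjoint U)" by (simp add: synthesis_surj[OF \<phi>])
  finally have "range X = orth_compl (kernel ?G) \<longleftrightarrow> R ` range (cadjoint U) = range (cadjoint U)"
    by (simp add: ranX inj_image_eq_iff[OF inj])
  also have "\<dots> \<longleftrightarrow> range (cadjoint U) = ?S ` range (cadjoint U)"
  proof
    assume *: "R ` range (cadjoint U) = range (cadjoint U)"
    have "?S ` R ` range (cadjoint U) = range (cadjoint U)" by (simp add: image_image R(5))
    then show "range (cadjoint U) = ?S ` range (cadjoint U)" by (simp only: *)
  next
    assume *: "range (cadjoint U) = ?S ` range (cadjoint U)"
    have "R ` ?S ` range (cadjoint U) = range (cadjoint U)" by (simp add: image_image R(4))
    then show "R ` range (cadjoint U) = range (cadjoint U)" by (simp only: *[symmetric])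
  qed
  finally have ran_iff: "range X = orth_compl (kernel ?G) \<longleftrightarrow>
      range (cadjoint U) = ?S ` range (cadjoint U)" .
  have a0: "analysis \<psi> f = 0 \<longleftrightarrow> f = 0" for f
    using injD[OF inj, of f 0] bounded_clinear_zero[OF bounded_clinear_analysis[OF b(1)]] by auto
  have R0: "R f = 0 \<longleftrightarrow> f = 0" for f using R(5)[of f] R(4)[of 0]
    by (auto simp: bounded_clinear_zero[OF R(1)] bounded_clinear_zero[OF bounded_clinear_frame_operator[OF b(1)]])
  \<comment> \<open>\<open>U\<dagger>\<close> is injective on \<open>R(U)\<close>, where \<open>T_\<phi>'\<close> takes its values.\<close>
  have U0: "pinv U (synthesis \<phi>' c) = 0 \<longleftrightarrow> synthesis \<phi>' c = 0" for c
  proof -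
    have "synthesis \<phi>' c \<in> range U" using ran_syn by blast
    then have "U (pinv U (synthesis \<phi>' c)) = synthesis \<phi>' c"
      using penrose_inverse_apply(1)[OF p] by auto
    then show ?thesis by (auto simp: bounded_clinear_zero[OF bpinv] bounded_clinear_zero[OF U(1)])
  qed
  have kerX: "kernel X = kernel (synthesis \<phi>')" by (simp add: kernel_def X a0 R0 U0)
  have kerG: "orth_compl (range ?G) = kernel (cadjoint U \<circ> synthesis \<phi>)"
    unfolding kernel_cadjoint[OF bG(1), symmetric] bG(2) by (simp add: kernel_def cross_gram_def a0)
  show ?thesis
    unfolding X_def[symmetric] pinv_eq_iff[OF bG(1) G] ran_iff kerX kerG using bX GXG by auto
qed

text \<open>The canonical dual of \<open>UU\<dagger>\<phi>\<close> always meets the kernel condition of the preceding lemma, so only the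
  range condition remains; any other dual that represents the pseudo-inverse forces the same range
  condition.\<close>

lemma pinv_cross_gram_canonical_dual:
  fixes U :: "'a::complex_hilbert_space \<Rightarrow> 'b::complex_hilbert_space"
  assumes \<psi>: "frame_on UNIV \<psi>" and \<phi>: "frame_on UNIV \<phi>"
    and U: "bounded_clinear U" "closed (range U)" and G: "closed (range (cross_gram U \<phi> \<psi>))"
  shows "pinv (cross_gram U \<phi> \<psi>) =
        cross_gram (pinv U) (canonical_dual UNIV \<psi>)
          (canonical_dual (range U) (\<lambda>i. U (pinv U (\<phi> i)))) \<longleftrightarrow>
      range (cadjoint U) = frame_operator \<psi> ` range (cadjoint U)" (is "?b \<longleftrightarrow> ?c")
    and "(\<exists>\<phi>'. dual_on (range U) \<phi> \<phi>' \<and>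
        pinv (cross_gram U \<phi> \<psi>) = cross_gram (pinv U) (canonical_dual UNIV \<psi>) \<phi>') \<longleftrightarrow>
      range (cadjoint U) = frame_operator \<psi> ` range (cadjoint U)" (is "?a \<longleftrightarrow> ?c")
proof -
  note can = canonical_dual_on_range[OF \<phi> U]
  note iff = pinv_cross_gram_dual_iff[OF \<psi> \<phi> U G]
  show bc: "?b \<longleftrightarrow> ?c" using iff[OF can(1)] can(2) by simp
  show "?a \<longleftrightarrow> ?c" using iff can(1) bc by blast
qed

theorem theorem4p5:
  fixes \<Psi> \<Phi> :: "'i::countable \<Rightarrow> 'h::complex_hilbert_space"
    and U :: "'h \<Rightarrow> 'h"
  assumes "separable_space (euclidean :: 'h topology)"
    and "frame_on UNIV \<Psi>"
    and "frame_on UNIV \<Phi>"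
    and "bounded_clinear U"
    and "closed (range U)"
    and "closed (range (cross_gram U \<Phi> \<Psi>))"
  shows
    "((\<exists>\<Phi>'. dual_on (range U) \<Phi> \<Phi>' \<and>
          pinv (cross_gram U \<Phi> \<Psi>) = cross_gram (pinv U) (canonical_dual UNIV \<Psi>) \<Phi>')
        \<longleftrightarrow>
        pinv (cross_gram U \<Phi> \<Psi>) =
          cross_gram (pinv U) (canonical_dual UNIV \<Psi>)
            (canonical_dual (range U) (\<lambda>i. U (pinv U (\<Phi> i)))))
     \<and> (pinv (cross_gram U \<Phi> \<Psi>) =
          cross_gram (pinv U) (canonical_dual UNIV \<Psi>)
            (canonical_dual (range U) (\<lambda>i. U (pinv U (\<Phi> i))))
        \<longleftrightarrow>
        range (cadjoint U) = frame_operator \<Psi> ` range (cadjoint U))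
     \<and> ((\<exists>\<Psi>'. dual_on (range (cadjoint U)) \<Psi> \<Psi>' \<and>
          pinv (cross_gram U \<Phi> \<Psi>) = cross_gram (pinv U) \<Psi>' (canonical_dual UNIV \<Phi>))
        \<longleftrightarrow>
        pinv (cross_gram U \<Phi> \<Psi>) =
          cross_gram (pinv U)
            (canonical_dual (range (cadjoint U)) (\<lambda>i. pinv U (U (\<Psi> i))))
            (canonical_dual UNIV \<Phi>))
     \<and> (pinv (cross_gram U \<Phi> \<Psi>) =
          cross_gram (pinv U)
            (canonical_dual (range (cadjoint U)) (\<lambda>i. pinv U (U (\<Psi> i))))
            (canonical_dual UNIV \<Phi>)
        \<longleftrightarrow>
        range U = frame_operator \<Phi> ` range U)"
proof -
  note \<Psi> = assms(2) and \<Phi> = assms(3) and U = assms(4,5) and G = assms(6)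
  have b: "bessel_on UNIV \<Psi>" "bessel_on UNIV \<Phi>" using \<Psi> \<Phi> by (simp_all add: frame_on_def)
  let ?G = "cross_gram U \<Phi> \<Psi>" and ?V = "cadjoint U"
  let ?d = "canonical_dual UNIV \<Phi>"
  let ?can = "canonical_dual (range ?V) (\<lambda>i. pinv U (U (\<Psi> i)))"
  note p = penrose_inverse_pinv[OF U]
  have bpinv: "bounded_clinear (pinv U)" using p by (simp add: penrose_inverse_def)
  have V: "bounded_clinear ?V" "closed (range ?V)"
    using bounded_clinear_cadjoint[OF U(1)] closed_range_cadjoint[OF U] by auto
  have VV: "cadjoint ?V = U" by (rule cadjoint_cadjoint[OF U(1)])
  note bG = cadjoint_cross_gram[OF b(2,1) U(1)]
  have GV: "closed (range (cross_gram ?V \<Psi> \<Phi>))"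
    using closed_range_cadjoint[OF bG(1) G] by (simp add: bG(2))
  have pinvG: "bounded_clinear (pinv ?G)"
    using penrose_inverse_pinv[OF bG(1) G] by (simp add: penrose_inverse_def)
  have bd: "bessel_on UNIV ?d"
  proof -
    obtain R where "bounded_clinear R" "?d = (\<lambda>i. R (\<Phi> i))" using canonical_dual_UNIV[OF \<Phi>] by blast
    then show ?thesis by (simp add: bessel_on_image[OF b(2) _ subset_UNIV])
  qed
  \<comment> \<open>Taking adjoints turns a representation of the pseudo-inverse of \<open>G*\<close> into one of that of \<open>G\<close>.\<close>
  have flip: "pinv (cross_gram ?V \<Psi> \<Phi>) = cross_gram (pinv ?V) ?d \<Psi>' \<longleftrightarrow>
      pinv ?G = cross_gram (pinv U) \<Psi>' ?d" if "dual_on (range ?V) \<Psi> \<Psi>'" for \<Psi>'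
  proof -
    have "bessel_on UNIV \<Psi>'"
      by (rule bessel_on_imp_UNIV[OF closed_csubspace_range[OF V]]) (use that in \<open>simp add: dual_on_def\<close>)
    note X = cadjoint_cross_gram[OF this bd bpinv]
    have "pinv (cross_gram ?V \<Psi> \<Phi>) = cadjoint (pinv ?G)"
      using pinv_cadjoint[OF bG(1) G] by (simp add: bG(2))
    moreover have "cross_gram (pinv ?V) ?d \<Psi>' = cadjoint (cross_gram (pinv U) \<Psi>' ?d)"
      by (simp add: X(2) pinv_cadjoint[OF U])
    moreover have "cadjoint (pinv ?G) = cadjoint (cross_gram (pinv U) \<Psi>' ?d) \<longleftrightarrow>
        pinv ?G = cross_gram (pinv U) \<Psi>' ?d"
      using cadjoint_cadjoint[OF pinvG] cadjoint_cadjoint[OF X(1)] by metis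
    ultimately show ?thesis by (simp only:)
  qed
  have "?V (pinv ?V x) = pinv U (U x)" for x
  proof -
    have "?V \<circ> cadjoint (pinv U) = pinv U \<circ> U"
      using p cadjoint_comp[OF bpinv U(1)] by (simp add: penrose_inverse_def)
    then show ?thesis by (auto simp: pinv_cadjoint[OF U] dest: fun_cong[where x = x])
  qed
  then have can: "canonical_dual (range ?V) (\<lambda>i. ?V (pinv ?V (\<Psi> i))) = ?can" by simp
  have dual: "dual_on (range ?V) \<Psi> ?can" using canonical_dual_on_range(1)[OF \<Psi> V] by (simp only: can)
  have part1: "(\<exists>\<Phi>'. dual_on (range U) \<Phi> \<Phi>' \<and>
          pinv ?G = cross_gram (pinv U) (canonical_dual UNIV \<Psi>) \<Phi>') \<longleftrightarrow>
        range ?V = frame_operator \<Psi> ` range ?V"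
    "pinv ?G = cross_gram (pinv U) (canonical_dual UNIV \<Psi>)
            (canonical_dual (range U) (\<lambda>i. U (pinv U (\<Phi> i)))) \<longleftrightarrow>
        range ?V = frame_operator \<Psi> ` range ?V"
    by (rule pinv_cross_gram_canonical_dual[OF \<Psi> \<Phi> U G])+
  note dualV = pinv_cross_gram_canonical_dual[OF \<Phi> \<Psi> V GV, unfolded VV can]
  have part2: "(\<exists>\<Psi>'. dual_on (range ?V) \<Psi> \<Psi>' \<and> pinv ?G = cross_gram (pinv U) \<Psi>' ?d) \<longleftrightarrow>
        range U = frame_operator \<Phi> ` range U"
    "pinv ?G = cross_gram (pinv U) ?can ?d \<longleftrightarrow> range U = frame_operator \<Phi> ` range U"
    using dualV flip dual by blast+
  show ?thesis using part1 part2 by blast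
qed

end
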